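(* Let $J$ be a Jacobi matrix corresponding to a positive probability measure $d\mu$ whose support is equal to or contained in the interval $[-1,1]$, and let $x\in(-1,1)$ be such that the factorization $J-xI=LGL^{\top}$ exists, where $G$ is a diagonal matrix with diagonal entries $\pm1$ and $L$ is a real lower bidiagonal matrix with positive diagonal entries. Let $\widetilde J(x)$ be the operator in $\ell^2$ generated by the shifted Darboux transformation $GL^{\top}L+xI$ of $J$. Then the following statements are equivalent: (i) The shifted Darboux transformation $\widetilde J(x)$ is a definitizable operator in the Krein space $\ell^2(G)$. (ii) The relation $$\sigma(\widetilde J(x))\setminus\{x\}=\sigma(J)\setminus\{x\}$$ is valid. (iii) The set of the poles of the diagonal Padé approximants to the function $$\mathfrak F(\lambda)=\int_{-1}^{1}\frac{1}{t-\lambda}(t-x)\,d\mu(t)$$ does not have an accumulation point at infinity.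
   Context: All matrices are semi-infinite, indexed by $\{0,1,2,\dots\}$; $\ell^2$ is the Hilbert space of square summable complex sequences. A Jacobi matrix is a real symmetric tridiagonal matrix $J$ with diagonal entries $b_k\in\mathbb R$ and off-diagonal entries $a_k>0$, $k=0,1,\dots$. It corresponds to the positive probability measure $d\mu$ (with infinite support) if the polynomials $P_n$ orthonormal with respect to $d\mu$, with $P_0=1$, satisfy $Jp(t)=tp(t)$, where $p=(P_0,P_1,\dots)^{\top}$. The factorization $J-xI=LGL^{\top}$ is unique if it exists. The operator generated by a tridiagonal matrix in $\ell^2$ (denoted by the same symbol) is the closure of the operator acting by matrix multiplication on finitely supported sequences. Spectra $\sigma(\cdot)$ and resolvent sets $\rho(\cdot)$ are taken in $\ell^2$. The Krein space $\ell^2(G)$ is the linear space $\ell^2$ equipped with the inner product $[f,g]=(Gf,g)_{\ell^2}$. An operator $A$ is self-adjoint in $\ell^2(G)$ if $GA$ is self-adjoint in $\ell^2$. An operator $A$ in $\ell^2(G)$, generated by a tridiagonal matrix, is called definitizable if it is self-adjoint in $\ell^2(G)$, $\rho(A)\ne\emptyset$, and there exists a real polynomial $h\not\equiv0$ such that $[h(A)f,f]\ge0$ for all $f\in\ell^2(G)$ having only a finite number of nonzero entries. The $n$-th diagonal Padé approximant to $\mathfrak F$ is a rational function $\mathcal Q_n/\mathcal P_n$ with $\deg\mathcal P_n=n$, $\deg\mathcal Q_n\le n$ and $\mathfrak F(\lambda)-\frac{\mathcal Q_n(\lambda)}{\mathcal P_n(\lambda)}=O\left(\lambda^{-(2n+1)}\right)$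 as $\lambda\to\infty$. The set of poles in (iii) is the union over all $n$ of the poles of the $n$-th diagonal Padé approximants; having no accumulation point at infinity means that this set is bounded. *)

theory Defs
  imports
    "HOL-Probability.Probability"
    "HOL-Complex_Analysis.Complex_Analysis"
    "HOL-Computational_Algebra.Polynomial"
begin

section \<open>The Hilbert space of square summable sequences\<close>

typedef ell2 = "{f :: nat \<Rightarrow> complex. summable (\<lambda>k. (cmod (f k))\<^sup>2)}"
  morphisms ell2_nth Abs_ell2
  by (rule exI[of _ "\<lambda>_. 0"]) simp

setup_lifting type_definition_ell2

lemma summable_sq_add:
  assumes "summable (\<lambda>k. (cmod (f k))\<^sup>2)" "summable (\<lambda>k. (cmod (g k))\<^sup>2)"
  shows "summable (\<lambda>k. (cmod (f k + g k))\<^sup>2)"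
proof (rule summable_comparison_test')
  show "summable (\<lambda>k. 2 * (cmod (f k))\<^sup>2 + 2 * (cmod (g k))\<^sup>2)"
    using assms by (intro summable_add summable_mult)
  fix k :: nat
  have "(cmod (f k + g k))\<^sup>2 \<le> (cmod (f k) + cmod (g k))\<^sup>2"
    by (intro power_mono norm_triangle_ineq norm_ge_zero)
  also have "\<dots> \<le> 2 * (cmod (f k))\<^sup>2 + 2 * (cmod (g k))\<^sup>2"
    using zero_le_power2[of "cmod (f k) - cmod (g k)"]
    by (simp add: power2_sum power2_diff)
  finally show "norm ((cmod (f k + g k))\<^sup>2) \<le> 2 * (cmod (f k))\<^sup>2 + 2 * (cmod (g k))\<^sup>2"
    by simp
qed

lemma summable_sq_scale:
  assumes "summable (\<lambda>k. (cmod (f k))\<^sup>2)"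
  shows "summable (\<lambda>k. (cmod (c * f k))\<^sup>2)"
  using assms by (simp add: norm_mult power_mult_distrib summable_mult)

lemma summable_sq_prod:
  assumes "summable (\<lambda>k. (cmod (f k))\<^sup>2)" "summable (\<lambda>k. (cmod (g k))\<^sup>2)"
  shows "summable (\<lambda>k. f k * cnj (g k))"
proof (rule summable_comparison_test')
  show "summable (\<lambda>k. (cmod (f k))\<^sup>2 + (cmod (g k))\<^sup>2)"
    using assms by (rule summable_add)
  fix k :: nat
  have "0 \<le> (cmod (f k) - cmod (g k))\<^sup>2" "0 \<le> cmod (f k) * cmod (g k)"
    by simp_all
  then show "norm (f k * cnj (g k)) \<le> (cmod (f k))\<^sup>2 + (cmod (g k))\<^sup>2"
    unfolding power2_diff norm_mult complex_mod_cnj by linarith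
qed

instantiation ell2 :: real_vector
begin

lift_definition zero_ell2 :: ell2 is "\<lambda>_. 0" by simp
lift_definition plus_ell2 :: "ell2 \<Rightarrow> ell2 \<Rightarrow> ell2" is "\<lambda>f g k. f k + g k"
  by (rule summable_sq_add)
lift_definition uminus_ell2 :: "ell2 \<Rightarrow> ell2" is "\<lambda>f k. - f k" by simp
lift_definition minus_ell2 :: "ell2 \<Rightarrow> ell2 \<Rightarrow> ell2" is "\<lambda>f g k. f k - g k"
  subgoal for f g using summable_sq_add[of f "\<lambda>k. - g k"] by simp
  done
lift_definition scaleR_ell2 :: "real \<Rightarrow> ell2 \<Rightarrow> ell2" is "\<lambda>r f k. complex_of_real r * f k"
  by (rule summable_sq_scale)

instance
  by standard (transfer; simp add: fun_eq_iff algebra_simps)+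

end

lift_definition scaleC :: "complex \<Rightarrow> ell2 \<Rightarrow> ell2" (infixr "*\<^sub>C" 75)
  is "\<lambda>c f k. c * f k"
  by (rule summable_sq_scale)

lift_definition cinner :: "ell2 \<Rightarrow> ell2 \<Rightarrow> complex" is "\<lambda>f g. \<Sum>k. f k * cnj (g k)" .

text \<open>
  The real inner product space structure (the real part of \<^const>\<open>cinner\<close>) supplies the norm
  \<open>sqrt (\<Sum>k. (cmod (f k))\<^sup>2)\<close> and its topology.
\<close>

instantiation ell2 :: real_inner
begin

definition inner_ell2 :: "ell2 \<Rightarrow> ell2 \<Rightarrow> real" where
  "inner_ell2 f g = Re (cinner f g)"
definition norm_ell2 :: "ell2 \<Rightarrow> real" where
  "norm_ell2 f = sqrt (inner f f)"
definition dist_ell2 :: "ell2 \<Rightarrow> ell2 \<Rightarrow> real" where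
  "dist_ell2 f g = norm (f - g)"
definition sgn_ell2 :: "ell2 \<Rightarrow> ell2" where
  "sgn_ell2 f = f /\<^sub>R norm f"
definition uniformity_ell2 :: "(ell2 \<times> ell2) filter" where
  "uniformity_ell2 = (INF e\<in>{0 <..}. principal {(x, y). dist x y < e})"
definition open_ell2 :: "ell2 set \<Rightarrow> bool" where
  "open_ell2 U = (\<forall>x\<in>U. eventually (\<lambda>(x', y). x' = x \<longrightarrow> y \<in> U) uniformity)"

lemma cinner_summable: "summable (\<lambda>k. ell2_nth f k * cnj (ell2_nth g k))"
  using ell2_nth[of f] ell2_nth[of g] by (intro summable_sq_prod) auto

lemma cinner_self: "cinner f f = of_real (\<Sum>k. (cmod (ell2_nth f k))\<^sup>2)"
proof -
  have "summable (\<lambda>k. (cmod (ell2_nth f k))\<^sup>2)"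
    using ell2_nth[of f] by simp
  then show ?thesis
    by (simp add: cinner.rep_eq complex_norm_square[symmetric] suminf_of_real)
qed

instance
proof
  fix f g h :: ell2 and r :: real
  show "inner f g = inner g f"
  proof -
    have "cinner g f = cnj (cinner f g)"
      unfolding cinner.rep_eq
      using sums_cnj[of "\<lambda>k. ell2_nth f k * cnj (ell2_nth g k)"] cinner_summable[of f g]
      by (metis (no_types, lifting) ext complex_cnj_cnj complex_cnj_mult mult.commute
          sums_unique summable_sums)
    then show ?thesis by (simp add: inner_ell2_def)
  qed
  show "inner (f + g) h = inner f h + inner g h"
    using suminf_add[OF cinner_summable[of f h] cinner_summable[of g h]]
    by (simp add: inner_ell2_def cinner.rep_eq plus_ell2.rep_eq algebra_simps flip: plus_complex.sel(1))
  show "inner (r *\<^sub>R f) g = r * inner f g"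
    using suminf_mult[OF cinner_summable[of f g], of "of_real r"]
    by (simp add: inner_ell2_def cinner.rep_eq scaleR_ell2.rep_eq algebra_simps)
  have s: "summable (\<lambda>k. (cmod (ell2_nth f k))\<^sup>2)"
    using ell2_nth[of f] by simp
  show "0 \<le> inner f f"
    using suminf_nonneg[OF s] by (simp add: inner_ell2_def cinner_self)
  show "inner f f = 0 \<longleftrightarrow> f = 0"
    using suminf_eq_zero_iff[OF s]
    by (auto simp: inner_ell2_def cinner_self zero_ell2.rep_eq fun_eq_iff simp flip: ell2_nth_inject)
qed (fact norm_ell2_def dist_ell2_def sgn_ell2_def uniformity_ell2_def open_ell2_def)+

end

lemma norm_ell2_eq: "norm f = sqrt (\<Sum>k. (cmod (ell2_nth f k))\<^sup>2)"
  by (simp add: norm_ell2_def inner_ell2_def cinner_self)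

definition finitely_supported :: "ell2 \<Rightarrow> bool" where
  "finitely_supported f \<longleftrightarrow> finite {k. ell2_nth f k \<noteq> 0}"


section \<open>Semi-infinite matrices\<close>

type_synonym smatrix = "nat \<Rightarrow> nat \<Rightarrow> real"

definition id_mat :: smatrix where
  "id_mat i j = (if i = j then 1 else 0)"

definition transp_mat :: "smatrix \<Rightarrow> smatrix" where
  "transp_mat A i j = A j i"

text \<open>All products below are products of banded matrices, so the series are finite sums.\<close>

definition mat_mult :: "smatrix \<Rightarrow> smatrix \<Rightarrow> smatrix" (infixl "\<odot>" 70) where
  "(A \<odot> B) i j = (\<Sum>k. A i k * B k j)"

definition tridiagonal :: "smatrix \<Rightarrow> bool" where
  "tridiagonal A \<longleftrightarrow> (\<forall>i j. A i j \<noteq> 0 \<longrightarrow> i \<le> Suc j \<and> j \<le> Suc i)"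

definition lower_bidiagonal :: "smatrix \<Rightarrow> bool" where
  "lower_bidiagonal A \<longleftrightarrow> (\<forall>i j. A i j \<noteq> 0 \<longrightarrow> i = j \<or> i = Suc j)"

definition signature_matrix :: "smatrix \<Rightarrow> bool" where
  "signature_matrix G \<longleftrightarrow> (\<forall>i j. i \<noteq> j \<longrightarrow> G i j = 0) \<and> (\<forall>i. G i i = 1 \<or> G i i = -1)"

definition jacobi_matrix :: "smatrix \<Rightarrow> bool" where
  "jacobi_matrix J \<longleftrightarrow>
     tridiagonal J \<and> (\<forall>i j. J i j = J j i) \<and> (\<forall>k. J k (Suc k) > 0)"

definition LGL_factorization :: "smatrix \<Rightarrow> real \<Rightarrow> smatrix \<Rightarrow> smatrix \<Rightarrow> bool" where
  "LGL_factorization J x L G \<longleftrightarrow>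
     lower_bidiagonal L \<and> (\<forall>i. L i i > 0) \<and> signature_matrix G \<and>
     (\<forall>i j. J i j - x * id_mat i j = (L \<odot> G \<odot> transp_mat L) i j)"

definition shifted_darboux :: "real \<Rightarrow> smatrix \<Rightarrow> smatrix \<Rightarrow> smatrix" where
  "shifted_darboux x L G = (\<lambda>i j. (G \<odot> transp_mat L \<odot> L) i j + x * id_mat i j)"


section \<open>Orthogonality measures\<close>

definition measure_support :: "real measure \<Rightarrow> real set" where
  "measure_support \<mu> = {t. \<forall>U. open U \<and> t \<in> U \<longrightarrow> emeasure \<mu> U > 0}"

definition orthonormal_polys :: "real measure \<Rightarrow> (nat \<Rightarrow> real poly) \<Rightarrow> bool" where
  "orthonormal_polys \<mu> P \<longleftrightarrow>
     (\<forall>n. degree (P n) = n) \<and>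
     (\<forall>m n. (\<integral>t. poly (P m) t * poly (P n) t \<partial>\<mu>) = (if m = n then 1 else 0))"

definition corresponds_to :: "smatrix \<Rightarrow> real measure \<Rightarrow> bool" where
  "corresponds_to J \<mu> \<longleftrightarrow>
     (\<exists>P. orthonormal_polys \<mu> P \<and> P 0 = 1 \<and>
          (\<forall>t i. (\<Sum>j. J i j * poly (P j) t) = t * poly (P i) t))"

definition shifted_markov_function :: "real measure \<Rightarrow> real \<Rightarrow> complex \<Rightarrow> complex" where
  "shifted_markov_function \<mu> x z = (LINT t:{-1..1}|\<mu>. 1 / (of_real t - z) * of_real (t - x))"


section \<open>Operators in \<open>\<ell>\<^sup>2\<close>\<close>

text \<open>A (possibly unbounded) operator is represented by its graph.\<close>

type_synonym l2_operator = "(ell2 \<times> ell2) set"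

text \<open>
  \<open>Abs_ell2\<close> is only meaningful on square summable sequences; see the two lemmas below for the
  cases in which \<open>mat_apply\<close> is used.
\<close>

definition mat_apply :: "smatrix \<Rightarrow> ell2 \<Rightarrow> ell2" where
  "mat_apply A f = Abs_ell2 (\<lambda>i. \<Sum>j. of_real (A i j) * ell2_nth f j)"

lemma mat_apply_tridiagonal:
  assumes "tridiagonal A" "finitely_supported f"
  shows "ell2_nth (mat_apply A f) i = (\<Sum>j. of_real (A i j) * ell2_nth f j)"
    and "finitely_supported (mat_apply A f)"
proof -
  define g where "g i = (\<Sum>j. complex_of_real (A i j) * ell2_nth f j)" for i
  obtain N where N: "\<And>k. ell2_nth f k \<noteq> 0 \<Longrightarrow> k \<le> N"
    using assms(2) unfolding finitely_supported_def finite_nat_set_iff_bounded_le by blast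
  have g0: "g i = 0" if "i > Suc N" for i
  proof -
    have "complex_of_real (A i j) * ell2_nth f j = 0" for j
      using assms(1) N[of j] that unfolding tridiagonal_def by (cases "A i j = 0") force+
    then have "(\<lambda>j. complex_of_real (A i j) * ell2_nth f j) = (\<lambda>_. 0)" by blast
    then show ?thesis by (simp add: g_def)
  qed
  have "summable (\<lambda>k. (cmod (g k))\<^sup>2)"
    by (rule summable_finite[of "{..Suc N}"]) (auto simp: g0 not_le)
  then have *: "ell2_nth (mat_apply A f) = g"
    unfolding mat_apply_def g_def by (subst Abs_ell2_inverse) auto
  then show "ell2_nth (mat_apply A f) i = (\<Sum>j. of_real (A i j) * ell2_nth f j)"
    by (simp add: g_def)
  show "finitely_supported (mat_apply A f)"
    unfolding finitely_supported_def *
    by (rule finite_subset[of _ "{..Suc N}"]) (auto intro: leI dest: g0 simp: not_less[symmetric])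
qed

lemma mat_apply_signature:
  assumes "signature_matrix G"
  shows "ell2_nth (mat_apply G f) i = of_real (G i i) * ell2_nth f i"
proof -
  have eq: "(\<Sum>j. complex_of_real (G i j) * ell2_nth f j) = of_real (G i i) * ell2_nth f i" for i
    using suminf_finite[of "{i}" "\<lambda>j. complex_of_real (G i j) * ell2_nth f j"] assms
    by (auto simp: signature_matrix_def)
  have "cmod (of_real (G i i) * ell2_nth f i) = cmod (ell2_nth f i)" for i
    using assms by (auto simp: signature_matrix_def norm_mult) (metis abs_1 abs_minus mult_1)
  then have "summable (\<lambda>i. (cmod (of_real (G i i) * ell2_nth f i))\<^sup>2)"
    using ell2_nth[of f] by simp
  then show ?thesis
    unfolding mat_apply_def eq by (subst Abs_ell2_inverse) auto
qed

definition generated_operator :: "smatrix \<Rightarrow> l2_operator" where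
  "generated_operator A = closure {(f, mat_apply A f) | f. finitely_supported f}"

text \<open>
  \<open>z\<close> is in the resolvent set iff the graph of \<open>(A - z I)\<inverse>\<close> is the graph of a bounded,
  everywhere defined operator. Real linearity of \<open>R\<close> is all that has to be required: complex
  linearity is inherited from the graph.
\<close>

definition resolvent_set :: "l2_operator \<Rightarrow> complex set" where
  "resolvent_set A =
     {z. \<exists>R. bounded_linear R \<and> {(g - z *\<^sub>C f, f) | f g. (f, g) \<in> A} = {(h, R h) | h. True}}"

definition spectrum :: "l2_operator \<Rightarrow> complex set" where
  "spectrum A = - resolvent_set A"

definition adjoint_op :: "l2_operator \<Rightarrow> l2_operator" where
  "adjoint_op A = {(g, g'). \<forall>(f, f') \<in> A. cinner f' g = cinner f g'}"

definition selfadjoint_op :: "l2_operator \<Rightarrow> bool" where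
  "selfadjoint_op A \<longleftrightarrow> closure (Domain A) = UNIV \<and> adjoint_op A = A"

text \<open>
  \<open>poly_op h A\<close> is \<open>h(A)\<close> on its natural domain (that of \<open>A ^^ degree h\<close>); here \<open>A ^^ k\<close> is the
  relational power of the graph, i.e. the graph of the \<open>k\<close>-th iterate.
\<close>

definition poly_op :: "real poly \<Rightarrow> l2_operator \<Rightarrow> l2_operator" where
  "poly_op h A =
     {(f, \<Sum>k\<le>degree h. coeff h k *\<^sub>R u k) | f u. \<forall>k\<le>degree h. (f, u k) \<in> A ^^ k}"


section \<open>Definitizable operators in the Krein space \<open>\<ell>\<^sup>2(G)\<close>\<close>

definition krein_inner :: "smatrix \<Rightarrow> ell2 \<Rightarrow> ell2 \<Rightarrow> complex" where
  "krein_inner G f g = cinner (mat_apply G f) g"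

definition krein_selfadjoint :: "smatrix \<Rightarrow> l2_operator \<Rightarrow> bool" where
  "krein_selfadjoint G A \<longleftrightarrow> selfadjoint_op {(f, mat_apply G g) | f g. (f, g) \<in> A}"

definition definitizable :: "smatrix \<Rightarrow> l2_operator \<Rightarrow> bool" where
  "definitizable G A \<longleftrightarrow>
     (\<exists>T. tridiagonal T \<and> A = generated_operator T) \<and>
     krein_selfadjoint G A \<and> resolvent_set A \<noteq> {} \<and>
     (\<exists>h :: real poly. h \<noteq> 0 \<and>
        (\<forall>f. finitely_supported f \<longrightarrow>
           (\<exists>g. (f, g) \<in> poly_op h A \<and> krein_inner G g f \<in> \<real>\<^sub>\<ge>\<^sub>0)))"


section \<open>Diagonal Pade approximants at infinity\<close>

definition diagonal_pade ::
    "(complex \<Rightarrow> complex) \<Rightarrow> nat \<Rightarrow> complex poly \<Rightarrow> complex poly \<Rightarrow> bool" where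
  "diagonal_pade F n Q P \<longleftrightarrow>
     P \<noteq> 0 \<and> degree P = n \<and> degree Q \<le> n \<and>
     (\<lambda>z. F z - poly Q z / poly P z) \<in> O[at_infinity](\<lambda>z. 1 / z ^ (2 * n + 1))"

definition pade_poles :: "(complex \<Rightarrow> complex) \<Rightarrow> complex set" where
  "pade_poles F =
     {z. \<exists>n Q P. diagonal_pade F n Q P \<and> is_pole (\<lambda>w. poly Q w / poly P w) z}"

end

theory Submission
  imports Defs
begin

text \<open>
  All three conditions are equivalent to boundedness of the entries of \<open>L\<close>. If \<open>L\<close> is bounded, then
  \<open>J - x = L (G L\<^sup>T)\<close> and the transform minus \<open>x\<close>, \<open>(G L\<^sup>T) L\<close>, are products of the same two bounded
  operators in opposite order, so their spectra agree away from \<open>0\<close>, and \<open>h(t) = t - x\<close> is definitizing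
  because \<open>[G L\<^sup>T L f, f] = \<parallel>L f\<parallel>\<^sup>2\<close>. Conversely, (i) and (ii) both give the transform a nonreal
  resolvent point \<open>z\<close>, and a uniform bound on the columns of \<open>L\<close> can be read off the resolvent at \<open>z\<close>.
  For (iii), the denominators of the Pade approximants are the kernel polynomials
  \<open>(d\<^sub>n P\<^sub>n(t) + a\<^sub>n P\<^bsub>n+1\<^esub>(t)) / (t - x)\<close> with \<open>d\<^sub>n = G\<^bsub>nn\<^esub> L\<^bsub>nn\<^esub>\<^sup>2\<close>; away from the support
  \<open>a\<^sub>n P\<^bsub>n+1\<^esub>(t) / P\<^sub>n(t)\<close> differs from \<open>t\<close> by a bounded amount, so large zeros sit near \<open>- d\<^sub>n\<close>.
\<close>

section \<open>Sequence space\<close>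

text \<open>The obstacle is that the transform \<open>T\<close> is known only as the closure of a
  matrix on finitely supported sequences: while \<open>L\<close> may be unbounded, its domain is not
  explicit and \<open>L\<close> cannot simply be applied there. What survives the closure is the
  form (L f, L g) = (f, G (T - x) g): the indefinite \<open>G\<close> cancels, and graph convergence
  forces convergence of the images under \<open>L\<close>. Nonreal points matter because
  \<open>J\<close> is symmetric, so that \<open>Im z\<close> alone controls L u. Condition (i)
  supplies one because resolvent sets are open, (ii) because \<open>J\<close> is bounded; the latter
  holds as the entries of \<open>J\<close> are integrals of t P_i P_j over [-1,1]. On the Pade side
  the functional with density t - x may be indefinite, so zeros need not be real or simple. The
  factorization rescues the argument: the positive diagonal of \<open>L\<close> gives every kernel
  polynomial a nonzero moment of its own degree, which makes denominators unique up to scaling and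
  forbids cancellation. Zeros only see the numbers d_n; the subdiagonal of \<open>L\<close> is
  recovered from them and the diagonal of \<open>J\<close>.\<close>

lemma ell2_summable: "summable (\<lambda>k. (cmod (ell2_nth f k))\<^sup>2)"
  using ell2_nth[of f] by simp

lemmas ell2_nth_simps [simp] =
  plus_ell2.rep_eq minus_ell2.rep_eq uminus_ell2.rep_eq zero_ell2.rep_eq scaleR_ell2.rep_eq
  scaleC.rep_eq

lemma ell2_eqI: "(\<And>k. ell2_nth f k = ell2_nth g k) \<Longrightarrow> f = g"
  by (metis ell2_nth_inject ext)

lemma norm_ell2_sq: "(norm f)\<^sup>2 = (\<Sum>k. (cmod (ell2_nth f k))\<^sup>2)"
  unfolding norm_ell2_eq using suminf_nonneg[OF ell2_summable] by simp

lemma sum_le_norm_ell2: "finite I \<Longrightarrow> (\<Sum>k\<in>I. (cmod (ell2_nth f k))\<^sup>2) \<le> (norm f)\<^sup>2"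
  unfolding norm_ell2_sq by (rule sum_le_suminf[OF ell2_summable]) auto

lemma norm_ell2_le:
  assumes "0 \<le> c" "\<And>N. (\<Sum>k<N. (cmod (ell2_nth f k))\<^sup>2) \<le> c\<^sup>2"
  shows "norm f \<le> c"
proof -
  have "(norm f)\<^sup>2 \<le> c\<^sup>2"
    unfolding norm_ell2_sq using assms(2) by (rule suminf_le_const[OF ell2_summable])
  then show ?thesis
    using assms(1) by (rule power2_le_imp_le)
qed

text \<open>\<open>Abs_ell2\<close> is meaningful on square summable sequences only; a uniform bound
  on partial sums certifies this.\<close>

lemma ell2_nth_Abs:
  assumes "\<And>N. (\<Sum>k<N. (cmod (y k))\<^sup>2) \<le> c"
  shows "ell2_nth (Abs_ell2 y) = y"
proof -
  have "summable (\<lambda>k. (cmod (y k))\<^sup>2)"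
    by (rule bounded_imp_summable[where B = c]) (use assms in \<open>auto simp: lessThan_Suc_atMost[symmetric] simp del: sum.lessThan_Suc\<close>)
  then show ?thesis by (subst Abs_ell2_inverse) auto
qed

lemma cmod_ell2_nth_le: "cmod (ell2_nth f k) \<le> norm f"
proof -
  have "(cmod (ell2_nth f k))\<^sup>2 \<le> (norm f)\<^sup>2"
    using sum_le_norm_ell2[of "{k}" f] by simp
  then show ?thesis by (rule power2_le_imp_le) simp
qed

lemma norm_scaleC: "norm (c *\<^sub>C f) = cmod c * norm f"
proof -
  have "(norm (c *\<^sub>C f))\<^sup>2 = (cmod c * norm f)\<^sup>2"
    unfolding norm_ell2_sq power_mult_distrib
    using suminf_mult[OF ell2_summable[of f], of "(cmod c)\<^sup>2"]
    by (simp add: norm_mult power_mult_distrib)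
  then show ?thesis by (simp add: power2_eq_iff_nonneg)
qed

lemma scaleC_algebra:
  "c *\<^sub>C (f + g) = c *\<^sub>C f + c *\<^sub>C g" "c *\<^sub>C (f - g) = c *\<^sub>C f - c *\<^sub>C g"
  "(c + d) *\<^sub>C f = c *\<^sub>C f + d *\<^sub>C f" "(c - d) *\<^sub>C f = c *\<^sub>C f - d *\<^sub>C f"
  "c *\<^sub>C d *\<^sub>C f = (c * d) *\<^sub>C f" "1 *\<^sub>C f = f" "(- c) *\<^sub>C f = - (c *\<^sub>C f)"
  "of_real r *\<^sub>C f = r *\<^sub>R f" "c *\<^sub>C (- f) = - (c *\<^sub>C f)"
  by (auto intro!: ell2_eqI simp: algebra_simps)

lemma bounded_linear_scaleC: "bounded_linear (scaleC c)"
  by (rule bounded_linear_intro[where K = "cmod c"])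
     (auto simp: scaleC_algebra norm_scaleC intro!: ell2_eqI)

lemma bounded_linear_ell2_nth: "bounded_linear (\<lambda>f. ell2_nth f k)"
  by (rule bounded_linear_intro[where K = 1]) (auto simp: cmod_ell2_nth_le scaleR_conv_of_real)

lemmas tendsto_ell2_nth = bounded_linear.tendsto[OF bounded_linear_ell2_nth]

lemma cinner_sums: "(\<lambda>k. ell2_nth f k * cnj (ell2_nth g k)) sums cinner f g"
  unfolding cinner.rep_eq by (rule summable_sums[OF cinner_summable])

lemma cinner_add_left: "cinner (f + g) h = cinner f h + cinner g h"
  using sums_add[OF cinner_sums[of f h] cinner_sums[of g h]] cinner_sums[of "f + g" h]
  by (auto simp: algebra_simps intro: sums_unique2)

lemma cinner_scaleC_left: "cinner (c *\<^sub>C f) h = c * cinner f h"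
  using sums_mult[OF cinner_sums[of f h], of c] cinner_sums[of "c *\<^sub>C f" h]
  by (auto simp: algebra_simps intro: sums_unique2)

lemma cinner_commute: "cinner g f = cnj (cinner f g)"
proof -
  have "(\<lambda>k. cnj (ell2_nth f k * cnj (ell2_nth g k))) sums cnj (cinner f g)"
    unfolding sums_cnj by (rule cinner_sums)
  then show ?thesis
    using cinner_sums[of g f] by (auto simp: mult.commute intro: sums_unique2)
qed

lemma cinner_scaleC_right: "cinner h (c *\<^sub>C f) = cnj c * cinner h f"
  by (metis cinner_commute cinner_scaleC_left complex_cnj_mult)

lemma cinner_add_right: "cinner h (f + g) = cinner h f + cinner h g"
  by (metis cinner_commute cinner_add_left complex_cnj_add)

lemma cinner_self_norm: "cinner f f = of_real ((norm f)\<^sup>2)"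
  by (simp add: cinner_self norm_ell2_sq)

lemma cmod_cinner_le: "cmod (cinner f g) \<le> norm f * norm g"
proof (cases "cinner f g = 0")
  case False
  \<comment> \<open>A unimodular factor rotates the inner product onto the positive axis, where the
    real Cauchy-Schwarz inequality applies.\<close>
  define c where "c = cnj (sgn (cinner f g))"
  have c: "cmod c = 1"
    using False by (simp add: c_def norm_sgn)
  have "c * cinner f g = of_real (cmod (cinner f g))"
    using False by (simp add: c_def sgn_div_norm scaleR_conv_of_real mult.commute complex_norm_square[symmetric] power2_eq_square field_simps)
  then have "cmod (cinner f g) = inner (c *\<^sub>C f) g"
    by (simp add: inner_ell2_def cinner_scaleC_left)
  also have "\<dots> \<le> norm (c *\<^sub>C f) * norm g"
    by (rule norm_cauchy_schwarz)
  finally show ?thesis by (simp add: norm_scaleC c)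
qed simp

lemma bounded_bilinear_cinner: "bounded_bilinear cinner"
proof
  fix f g h :: ell2 and r :: real
  show "cinner (f + g) h = cinner f h + cinner g h" by (rule cinner_add_left)
  show "cinner h (f + g) = cinner h f + cinner h g" by (rule cinner_add_right)
  show "cinner (r *\<^sub>R f) g = r *\<^sub>R cinner f g"
    using cinner_scaleC_left[of "of_real r" f g] by (simp add: scaleC_algebra scaleR_conv_of_real)
  show "cinner f (r *\<^sub>R g) = r *\<^sub>R cinner f g"
    using cinner_scaleC_right[of f "of_real r" g] by (simp add: scaleC_algebra scaleR_conv_of_real)
  show "\<exists>K. \<forall>f g. norm (cinner f g) \<le> norm f * norm g * K"
    by (rule exI[of _ 1]) (simp add: cmod_cinner_le)
qed

lemmas tendsto_cinner = bounded_bilinear.tendsto[OF bounded_bilinear_cinner]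

lemma cinner_diff_right: "cinner h (f - g) = cinner h f - cinner h g"
  by (rule bounded_bilinear.diff_right[OF bounded_bilinear_cinner])

section \<open>Completeness and finite truncations\<close>

instance ell2 :: banach
proof
  fix X :: "nat \<Rightarrow> ell2"
  assume X: "Cauchy X"
  have "Cauchy (\<lambda>n. ell2_nth (X n) k)" for k
    using X by (rule bounded_linear.Cauchy[OF bounded_linear_ell2_nth])
  then have "\<forall>k. \<exists>a. (\<lambda>n. ell2_nth (X n) k) \<longlonglongrightarrow> a"
    using Cauchy_convergent_iff convergent_def by metis
  then obtain a where a: "\<And>k. (\<lambda>n. ell2_nth (X n) k) \<longlonglongrightarrow> a k" by metis
  obtain B where B: "\<And>n. norm (X n) \<le> B"
    using Cauchy_Bseq[OF X] unfolding Bseq_def by blast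
  have "(\<Sum>k<N. (cmod (a k))\<^sup>2) \<le> B\<^sup>2" for N
  proof (rule LIMSEQ_le_const2)
    show "(\<lambda>n. \<Sum>k<N. (cmod (ell2_nth (X n) k))\<^sup>2) \<longlonglongrightarrow> (\<Sum>k<N. (cmod (a k))\<^sup>2)"
      by (intro tendsto_intros a)
    have "(\<Sum>k<N. (cmod (ell2_nth (X n) k))\<^sup>2) \<le> B\<^sup>2" for n
      using sum_le_norm_ell2[of "{..<N}" "X n"] power_mono[OF B[of n], of 2] by simp
    then show "\<exists>M. \<forall>n\<ge>M. (\<Sum>k<N. (cmod (ell2_nth (X n) k))\<^sup>2) \<le> B\<^sup>2" by blast
  qed
  then have nth: "ell2_nth (Abs_ell2 a) = a" by (rule ell2_nth_Abs)
  have "X \<longlonglongrightarrow> Abs_ell2 a"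
  proof (rule LIMSEQ_I)
    fix e :: real assume "0 < e"
    then obtain M where M: "\<And>m n. m \<ge> M \<Longrightarrow> n \<ge> M \<Longrightarrow> norm (X m - X n) < e / 2"
      using X unfolding Cauchy_iff by (metis half_gt_zero)
    \<comment> \<open>On finitely many coordinates the Cauchy estimate passes to the limit in
      \<open>m\<close>; the bound does not depend on how many, so it holds for the norm.\<close>
    have "norm (X n - Abs_ell2 a) \<le> e / 2" if n: "n \<ge> M" for n
    proof (rule norm_ell2_le)
      fix N
      show "(\<Sum>k<N. (cmod (ell2_nth (X n - Abs_ell2 a) k))\<^sup>2) \<le> (e / 2)\<^sup>2"
        unfolding minus_ell2.rep_eq nth
      proof (rule LIMSEQ_le_const2)
        show "(\<lambda>m. \<Sum>k<N. (cmod (ell2_nth (X n) k - ell2_nth (X m) k))\<^sup>2)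
            \<longlonglongrightarrow> (\<Sum>k<N. (cmod (ell2_nth (X n) k - a k))\<^sup>2)"
          by (intro tendsto_intros a)
        have "(\<Sum>k<N. (cmod (ell2_nth (X n) k - ell2_nth (X m) k))\<^sup>2) \<le> (e / 2)\<^sup>2"
          if "m \<ge> M" for m
          using sum_le_norm_ell2[of "{..<N}" "X n - X m"]
            power_mono[OF less_imp_le[OF M[OF n that]], of 2] by simp
        then show "\<exists>M. \<forall>m\<ge>M. (\<Sum>k<N. (cmod (ell2_nth (X n) k - ell2_nth (X m) k))\<^sup>2) \<le> (e / 2)\<^sup>2"
          by blast
      qed
    qed (use \<open>0 < e\<close> in simp)
    with \<open>0 < e\<close> show "\<exists>M. \<forall>n\<ge>M. norm (X n - Abs_ell2 a) < e"
      by (metis field_sum_of_halves less_add_same_cancel1 half_gt_zero le_less_trans)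
  qed
  then show "convergent X" by (rule convergentI)
qed

lift_definition ell2_truncate :: "nat \<Rightarrow> ell2 \<Rightarrow> ell2" is "\<lambda>N f k. if k < N then f k else 0"
  subgoal for N f by (rule summable_finite[of "{..<N}"]) auto
  done

lift_definition ell2_unit :: "nat \<Rightarrow> ell2" is "\<lambda>n k. if k = n then 1 else 0"
  subgoal for n by (rule summable_finite[of "{n}"]) auto
  done

lemma finitely_supported_truncate: "finitely_supported (ell2_truncate N f)"
  unfolding finitely_supported_def ell2_truncate.rep_eq
  by (rule finite_subset[of _ "{..<N}"]) auto

lemma finitely_supported_unit: "finitely_supported (ell2_unit n)"
  unfolding finitely_supported_def ell2_unit.rep_eq by simp

lemma norm_ell2_unit [simp]: "norm (ell2_unit n) = 1"
proof -
  have "(norm (ell2_unit n))\<^sup>2 = 1"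
    unfolding norm_ell2_sq ell2_unit.rep_eq
    by (subst suminf_finite[of "{n}"]) auto
  then show ?thesis
    by (metis abs_norm_cancel real_sqrt_abs real_sqrt_one)
qed

lemma ell2_truncate_tendsto: "(\<lambda>N. ell2_truncate N f) \<longlonglongrightarrow> f"
proof -
  have eq: "(norm (ell2_truncate N f - f))\<^sup>2 = (norm f)\<^sup>2 - (\<Sum>k<N. (cmod (ell2_nth f k))\<^sup>2)" for N
  proof -
    let ?F = "\<lambda>k. (cmod (ell2_nth f k))\<^sup>2"
    have "(\<lambda>k. ?F k - (if k \<in> {..<N} then ?F k else 0)) sums ((norm f)\<^sup>2 - (\<Sum>k<N. ?F k))"
      unfolding norm_ell2_sq
      by (intro sums_diff summable_sums ell2_summable sums_If_finite_set) simp
    moreover have "?F k - (if k \<in> {..<N} then ?F k else 0) = (cmod (ell2_nth (ell2_truncate N f - f) k))\<^sup>2" for k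
      by (simp add: ell2_truncate.rep_eq)
    ultimately show ?thesis
      unfolding norm_ell2_sq[of "ell2_truncate N f - f"] by (simp add: sums_iff)
  qed
  have "(\<lambda>N. (norm f)\<^sup>2 - (\<Sum>k<N. (cmod (ell2_nth f k))\<^sup>2)) \<longlonglongrightarrow> (norm f)\<^sup>2 - (norm f)\<^sup>2"
    unfolding norm_ell2_sq by (intro tendsto_diff tendsto_const summable_LIMSEQ ell2_summable)
  then have "(\<lambda>N. (norm (ell2_truncate N f - f))\<^sup>2) \<longlonglongrightarrow> 0"
    unfolding eq by simp
  from tendsto_real_sqrt[OF this] have "(\<lambda>N. norm (ell2_truncate N f - f)) \<longlonglongrightarrow> 0"
    by simp
  then show ?thesis
    by (simp add: LIM_zero_iff tendsto_norm_zero_iff)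
qed

section \<open>Resolvents\<close>

text \<open>The Neumann series in fixed point form: solving \<open>f - P f = h\<close> means finding
  the fixed point of the contraction that takes \<open>f\<close> to \<open>h + P f\<close>.
  Linearity and boundedness of the inverse come from uniqueness and the lower bound
  \<open>(1 - c') * norm f\<close>.\<close>

lemma id_minus_contraction_inverse:
  fixes P :: "'a::banach \<Rightarrow> 'a"
  assumes P: "bounded_linear P" and c: "c < 1" "\<And>f. norm (P f) \<le> c * norm f"
  obtains N where "bounded_linear N" "\<And>f. N (f - P f) = f" "\<And>h. N h - P (N h) = h"
proof -
  interpret P: bounded_linear P by (rule P)
  \<comment> \<open>The fixed point theorem wants a nonnegative constant, and the sign of
    \<open>c\<close> is left open.\<close>
  define c' where "c' = max c 0"
  have c': "0 \<le> c'" "c' < 1" "\<And>f. norm (P f) \<le> c' * norm f"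
    using c by (auto simp: c'_def intro: order_trans[OF c(2) mult_right_mono])
  have "\<exists>!f. h + P f = f" for h
  proof -
    have "dist (h + P f) (h + P g) \<le> c' * dist f g" for f g
      using c'(3)[of "f - g"] by (simp add: dist_norm P.diff)
    then show ?thesis
      using c' by (intro banach_fix_type[of c']) auto
  qed
  then obtain N where N: "\<And>h. h + P (N h) = N h" by metis
  have lower: "(1 - c') * norm f \<le> norm (f - P f)" for f
    using c'(3)[of f] norm_triangle_ineq2[of f "P f"] by (simp add: algebra_simps)
  have uniq: "f = g" if "f - P f = g - P g" for f g
  proof -
    have "(f - g) - P (f - g) = 0"
      using that by (simp add: P.diff algebra_simps)
    with lower[of "f - g"] have "(1 - c') * norm (f - g) \<le> 0" by simp
    then show ?thesis
      using c'(2) by (simp add: mult_le_0_iff)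
  qed
  have right: "N h - P (N h) = h" for h
    using N[of h] by (metis add_diff_cancel_right')
  have left: "N (f - P f) = f" for f
    by (rule uniq) (rule right)
  have "bounded_linear N"
  proof (rule bounded_linear_intro[where K = "1 / (1 - c')"])
    show "N (f + g) = N f + N g" for f g
    proof (rule uniq)
      have "N f + N g - P (N f + N g) = (N f - P (N f)) + (N g - P (N g))"
        by (simp add: P.add)
      then show "N (f + g) - P (N (f + g)) = N f + N g - P (N f + N g)"
        by (simp only: right)
    qed
    show "N (r *\<^sub>R f) = r *\<^sub>R N f" for r f
    proof (rule uniq)
      have "r *\<^sub>R N f - P (r *\<^sub>R N f) = r *\<^sub>R (N f - P (N f))"
        by (simp add: P.scaleR scaleR_right_diff_distrib)
      then show "N (r *\<^sub>R f) - P (N (r *\<^sub>R f)) = r *\<^sub>R N f - P (r *\<^sub>R N f)"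
        by (simp only: right)
    qed
    show "norm (N f) \<le> norm f * (1 / (1 - c'))" for f
      using lower[of "N f"] c'(2) by (simp add: right field_simps)
  qed
  then show ?thesis using left right by (rule that)
qed

text \<open>Equality of the two graphs splits into inclusions: \<open>R\<close> is a left inverse on
  the domain of \<open>A\<close>, and a right inverse with values in that domain.\<close>

lemma resolvent_set_iff:
  "z \<in> resolvent_set A \<longleftrightarrow>
     (\<exists>R. bounded_linear R \<and> (\<forall>f g. (f, g) \<in> A \<longrightarrow> R (g - z *\<^sub>C f) = f) \<and>
          (\<forall>h. (R h, h + z *\<^sub>C R h) \<in> A))"
proof -
  have "{(g - z *\<^sub>C f, f) | f g. (f, g) \<in> A} = {(h, R h) | h. True} \<longleftrightarrow>
      (\<forall>f g. (f, g) \<in> A \<longrightarrow> R (g - z *\<^sub>C f) = f) \<and> (\<forall>h. (R h, h + z *\<^sub>C R h) \<in> A)" (is "?l \<longleftrightarrow> ?r") for R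
  proof
    assume l: ?l
    show ?r
    proof (intro conjI allI impI)
      fix f g assume "(f, g) \<in> A"
      then have "(g - z *\<^sub>C f, f) \<in> {(h, R h) | h. True}"
        unfolding l[symmetric] by blast
      then show "R (g - z *\<^sub>C f) = f" by simp
    next
      fix h
      have "(h, R h) \<in> {(g - z *\<^sub>C f, f) | f g. (f, g) \<in> A}"
        unfolding l by blast
      then obtain g where "h = g - z *\<^sub>C R h" "(R h, g) \<in> A" by auto
      then show "(R h, h + z *\<^sub>C R h) \<in> A" by (simp add: algebra_simps)
    qed
  next
    assume r: ?r
    show ?l
    proof (intro set_eqI iffI)
      fix p assume "p \<in> {(h, R h) | h. True}"
      then obtain h where p: "p = (h, R h)" by blast
      have "p = ((h + z *\<^sub>C R h) - z *\<^sub>C R h, R h)" by (simp add: p)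
      then show "p \<in> {(g - z *\<^sub>C f, f) | f g. (f, g) \<in> A}"
        using r by blast
    qed (use r in auto)
  qed
  then show ?thesis unfolding resolvent_set_def by simp
qed

text \<open>On the domain, A - z = (I - (z - z0) R0) (A - z0). If \<open>N\<close> inverts the first
  factor, the new resolvent is \<open>R0\<close> after \<open>N\<close>. Only \<open>R0\<close> has
  to be bounded, so \<open>A\<close> may be unbounded.\<close>

lemma open_resolvent_set: "open (resolvent_set A)"
  unfolding open_dist
proof
  fix z0 assume "z0 \<in> resolvent_set A"
  then obtain R0 where R0: "bounded_linear R0" "\<And>f g. (f, g) \<in> A \<Longrightarrow> R0 (g - z0 *\<^sub>C f) = f"
      "\<And>h. (R0 h, h + z0 *\<^sub>C R0 h) \<in> A"
    unfolding resolvent_set_iff by blast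
  obtain K where K: "0 < K" "\<And>h. norm (R0 h) \<le> norm h * K"
    using bounded_linear.pos_bounded[OF R0(1)] by blast
  have "z \<in> resolvent_set A" if z: "dist z z0 < 1 / K" for z
  proof -
    define P where "P h = (z - z0) *\<^sub>C R0 h" for h
    have "bounded_linear P"
      unfolding P_def by (intro bounded_linear_compose[OF bounded_linear_scaleC] R0(1))
    moreover have "cmod (z - z0) * K < 1"
      using z K(1) by (simp add: dist_norm field_simps)
    moreover have "norm (P h) \<le> cmod (z - z0) * K * norm h" for h
      using K(2)[of h] by (simp add: P_def norm_scaleC mult_left_mono mult.assoc mult.commute[of K])
    ultimately obtain N where N: "bounded_linear N" "\<And>f. N (f - P f) = f" "\<And>h. N h - P (N h) = h"
      using id_minus_contraction_inverse by blast
    have "bounded_linear (\<lambda>h. R0 (N h))"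
      by (intro bounded_linear_compose[OF R0(1)] N(1))
    moreover have "R0 (N (g - z *\<^sub>C f)) = f" if fg: "(f, g) \<in> A" for f g
    proof -
      have "g - z *\<^sub>C f = (g - z0 *\<^sub>C f) - P (g - z0 *\<^sub>C f)"
        by (simp add: P_def R0(2)[OF fg] scaleC_algebra)
      then show ?thesis by (simp only: N(2) R0(2)[OF fg])
    qed
    moreover have "(R0 (N h), h + z *\<^sub>C R0 (N h)) \<in> A" for h
    proof -
      have "h + z *\<^sub>C R0 (N h) = (N h - P (N h)) + z *\<^sub>C R0 (N h)" by (simp only: N(3))
      also have "\<dots> = N h + z0 *\<^sub>C R0 (N h)" by (simp add: P_def scaleC_algebra)
      finally show ?thesis using R0(3)[of "N h"] by simp
    qed
    ultimately show ?thesis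
      unfolding resolvent_set_iff by blast
  qed
  then show "\<exists>e>0. \<forall>y. dist y z0 < e \<longrightarrow> y \<in> resolvent_set A"
    using K(1) by (intro exI[of _ "1 / K"]) auto
qed

lemma resolvent_set_graph_iff:
  "z \<in> resolvent_set (range (\<lambda>f. (f, S f))) \<longleftrightarrow>
     (\<exists>R. bounded_linear R \<and> (\<forall>f. R (S f - z *\<^sub>C f) = f) \<and> (\<forall>h. S (R h) - z *\<^sub>C R h = h))"
proof -
  have "(R h, h + z *\<^sub>C R h) \<in> range (\<lambda>f. (f, S f)) \<longleftrightarrow> S (R h) - z *\<^sub>C R h = h" for R :: "ell2 \<Rightarrow> ell2" and h
    by (auto simp: image_iff algebra_simps)
  then show ?thesis unfolding resolvent_set_iff by auto
qed

text \<open>S - z = -z (I - S/z), and S/z is a contraction once \<open>cmod z\<close> exceeds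
  \<open>K\<close>.\<close>

lemma resolvent_set_bounded_graph:
  assumes S: "bounded_linear S" and K: "\<And>f. norm (S f) \<le> norm f * K" and z: "K < cmod z" "z \<noteq> 0"
  shows "z \<in> resolvent_set (range (\<lambda>f. (f, S f)))"
proof -
  define P where "P f = (1 / z) *\<^sub>C S f" for f
  have "bounded_linear P"
    unfolding P_def by (intro bounded_linear_compose[OF bounded_linear_scaleC] S)
  moreover have "K / cmod z < 1"
    using z by simp
  moreover have "norm (P f) \<le> K / cmod z * norm f" for f
    using K[of f] z by (simp add: P_def norm_scaleC norm_divide divide_right_mono mult.commute)
  ultimately obtain N where N: "bounded_linear N" "\<And>f. N (f - P f) = f" "\<And>h. N h - P (N h) = h"
    using id_minus_contraction_inverse by blast
  have "bounded_linear (\<lambda>h. N ((- 1 / z) *\<^sub>C h))"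
    by (intro bounded_linear_compose[OF N(1)] bounded_linear_scaleC)
  moreover have "N ((- 1 / z) *\<^sub>C (S f - z *\<^sub>C f)) = f" for f
  proof -
    have "(- 1 / z) *\<^sub>C (S f - z *\<^sub>C f) = f - P f"
      using z by (intro ell2_eqI) (simp add: P_def field_simps)
    then show ?thesis by (simp only: N(2))
  qed
  moreover have "S (N ((- 1 / z) *\<^sub>C h)) - z *\<^sub>C N ((- 1 / z) *\<^sub>C h) = h" for h
  proof -
    let ?k = "N ((- 1 / z) *\<^sub>C h)"
    have "S ?k - z *\<^sub>C ?k = (- z) *\<^sub>C (?k - P ?k)"
      using z by (intro ell2_eqI) (simp add: P_def field_simps)
    also have "\<dots> = h"
      unfolding N(3) using z by (simp add: scaleC_algebra)
    finally show ?thesis .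
  qed
  ultimately show ?thesis
    unfolding resolvent_set_graph_iff by blast
qed

text \<open>With w = z - x, the resolvent transfers by (BA - w)^-1 = (1/w) (B (AB - w)^-1 A - I).
  The division by w is why the point \<open>x\<close> is set aside.\<close>

lemma resolvent_set_swap:
  assumes A: "bounded_linear A" "\<And>c f. A (c *\<^sub>C f) = c *\<^sub>C A f"
    and B: "bounded_linear B" "\<And>c f. B (c *\<^sub>C f) = c *\<^sub>C B f"
    and z: "z \<noteq> complex_of_real x"
    and AB: "z \<in> resolvent_set (range (\<lambda>f. (f, A (B f) + x *\<^sub>R f)))"
  shows "z \<in> resolvent_set (range (\<lambda>f. (f, B (A f) + x *\<^sub>R f)))"
proof -
  interpret A: bounded_linear A by (rule A)
  interpret B: bounded_linear B by (rule B)
  define w where "w = z - of_real x"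
  have w: "w \<noteq> 0" using z by (simp add: w_def)
  have shift: "g + x *\<^sub>R f - z *\<^sub>C f = g - w *\<^sub>C f" for f g
    by (simp add: w_def scaleC_algebra)
  obtain R where R: "bounded_linear R" "\<And>f. R (A (B f) - w *\<^sub>C f) = f" "\<And>h. A (B (R h)) - w *\<^sub>C R h = h"
    using AB unfolding resolvent_set_graph_iff shift by blast
  define R' where "R' h = (1 / w) *\<^sub>C (B (R (A h)) - h)" for h
  have "bounded_linear R'"
    unfolding R'_def
    by (intro bounded_linear_compose[OF bounded_linear_scaleC] bounded_linear_sub
        bounded_linear_compose[OF B(1)] bounded_linear_compose[OF R(1)] A(1) bounded_linear_ident)
  moreover have "R' (B (A f) - w *\<^sub>C f) = f" for f
  proof -
    have "R (A (B (A f) - w *\<^sub>C f)) = A f"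
      using R(2)[of "A f"] by (simp add: A.diff A(2))
    then show ?thesis
      unfolding R'_def using w by (simp add: scaleC_algebra)
  qed
  moreover have "B (A (R' h)) - w *\<^sub>C R' h = h" for h
  proof -
    have "B (A (B (R (A h)) - h)) = B (A (B (R (A h)))) - B (A h)"
      by (simp add: A.diff B.diff)
    also have "A (B (R (A h))) = A h + w *\<^sub>C R (A h)"
      using R(3)[of "A h"] by (simp add: algebra_simps)
    finally have "B (A (B (R (A h)) - h)) = w *\<^sub>C B (R (A h))"
      by (simp add: B.add B(2))
    then show ?thesis
      unfolding R'_def A(2) B(2) using w by (simp add: scaleC_algebra)
  qed
  ultimately show ?thesis
    unfolding resolvent_set_graph_iff shift by blast
qed

lemma selfadjoint_op_graph:
  assumes "\<And>f g. cinner (S f) g = cinner f (S g)"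
  shows "selfadjoint_op (range (\<lambda>f. (f, S f)))"
proof -
  have "Domain (range (\<lambda>f. (f, S f))) = UNIV" by auto
  \<comment> \<open>Test against \<open>S g - g'\<close> itself, which is possible because
    \<open>S\<close> is defined everywhere.\<close>
  moreover have "g' = S g" if "\<And>f. cinner (S f) g = cinner f g'" for g g'
  proof -
    have "cinner (S g - g') (S g - g') = 0"
      using that[of "S g - g'"] by (simp add: assms cinner_diff_right)
    then show ?thesis by (simp add: cinner_self_norm)
  qed
  then have "adjoint_op (range (\<lambda>f. (f, S f))) = range (\<lambda>f. (f, S f))"
    unfolding adjoint_op_def by (auto simp: assms)
  ultimately show ?thesis
    unfolding selfadjoint_op_def by simp
qed

section \<open>Tridiagonal matrices\<close>

text \<open>Acts on arbitrary sequences: rows of a tridiagonal matrix are finite, so matrix products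
  can be applied before square summability is known.\<close>

definition seq_apply :: "smatrix \<Rightarrow> (nat \<Rightarrow> complex) \<Rightarrow> nat \<Rightarrow> complex" where
  "seq_apply A y i = (\<Sum>j. of_real (A i j) * y j)"

text \<open>For tridiagonal matrices, bounded entries already give a bounded operator.\<close>

definition bounded_matrix :: "smatrix \<Rightarrow> bool" where
  "bounded_matrix A \<longleftrightarrow> (\<exists>C. \<forall>i j. \<bar>A i j\<bar> \<le> C)"

lemma tridiagonal_zero: "tridiagonal A \<Longrightarrow> Suc i < j \<or> Suc j < i \<Longrightarrow> A i j = 0"
  unfolding tridiagonal_def by (metis not_less)

lemma seq_apply_tridiagonal:
  assumes "tridiagonal A" "i + 2 \<le> n"
  shows "seq_apply A y i = (\<Sum>j<n. of_real (A i j) * y j)"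
  unfolding seq_apply_def using assms by (intro suminf_finite) (auto simp: tridiagonal_zero)

lemma suminf_tridiagonal:
  fixes y :: "nat \<Rightarrow> 'a::real_normed_algebra_1"
  assumes A: "tridiagonal A"
  shows "(\<Sum>j. of_real (A i j) * y j) = of_real (A i i) * y i + of_real (A i (Suc i)) * y (Suc i)
    + (if i = 0 then 0 else of_real (A i (i - 1)) * y (i - 1))"
proof -
  have *: "(\<Sum>j. of_real (A i j) * y j) = (\<Sum>j<i + 2. of_real (A i j) * y j)"
    using A by (intro suminf_finite) (auto simp: tridiagonal_zero)
  show ?thesis
  proof (cases i)
    case 0
    then show ?thesis
      unfolding * by (simp add: numeral_2_eq_2)
  next
    case (Suc k)
    have "(\<Sum>j<k. of_real (A (Suc k) j) * y j) = 0"
      using A by (intro sum.neutral) (auto simp: tridiagonal_zero)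
    then show ?thesis
      unfolding * using Suc by (simp add: numeral_2_eq_2)
  qed
qed

lemma seq_apply_three:
  "tridiagonal A \<Longrightarrow> seq_apply A y i = of_real (A i i) * y i + of_real (A i (Suc i)) * y (Suc i)
    + (if i = 0 then 0 else of_real (A i (i - 1)) * y (i - 1))"
  unfolding seq_apply_def by (rule suminf_tridiagonal)

lemma mat_mult_tridiagonal:
  assumes "tridiagonal A" "i + 2 \<le> n"
  shows "(A \<odot> B) i j = (\<Sum>k<n. A i k * B k j)"
  unfolding mat_mult_def using assms by (intro suminf_finite) (auto simp: tridiagonal_zero)

lemma seq_apply_mult:
  assumes A: "tridiagonal A" and B: "tridiagonal B"
  shows "seq_apply (A \<odot> B) y i = seq_apply A (seq_apply B y) i"
proof -
  \<comment> \<open>Row \<open>i\<close> of \<open>A\<close> is supported below \<open>?n\<close>,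
    and the rows of \<open>B\<close> that it meets are supported below \<open>?N\<close>, so all
    sums to be interchanged are finite.\<close>
  let ?n = "i + 2" and ?N = "i + 4"
  have AB: "(A \<odot> B) i j = (\<Sum>k<?n. A i k * B k j)" for j
    by (rule mat_mult_tridiagonal[OF A order_refl])
  have zero: "(A \<odot> B) i j = 0" if "?N \<le> j" for j
    unfolding AB using that B by (intro sum.neutral) (auto simp: tridiagonal_zero)
  have "seq_apply (A \<odot> B) y i = (\<Sum>j<?N. of_real ((A \<odot> B) i j) * y j)"
    unfolding seq_apply_def by (rule suminf_finite) (auto simp: zero)
  also have "\<dots> = (\<Sum>k<?n. \<Sum>j<?N. of_real (A i k) * (of_real (B k j) * y j))"
    unfolding AB of_real_sum sum_distrib_right by (subst sum.swap) (simp add: mult.assoc)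
  also have "\<dots> = (\<Sum>k<?n. of_real (A i k) * seq_apply B y k)"
  proof (intro sum.cong refl)
    fix k assume "k \<in> {..<?n}"
    then show "(\<Sum>j<?N. of_real (A i k) * (of_real (B k j) * y j)) = of_real (A i k) * seq_apply B y k"
      by (subst seq_apply_tridiagonal[OF B, of _ ?N]) (auto simp: sum_distrib_left)
  qed
  finally show ?thesis
    by (simp add: seq_apply_tridiagonal[OF A order_refl])
qed

lemma mat_apply_eq: "mat_apply A f = Abs_ell2 (seq_apply A (ell2_nth f))"
  unfolding mat_apply_def seq_apply_def ..

text \<open>Squaring a sum of three terms costs a factor 3, and adding up the three diagonals costs
  another; together they give 9 C^2, the square of \<open>3 * C\<close>.\<close>

lemma seq_apply_bound:
  assumes A: "tridiagonal A" and C: "\<And>i j. \<bar>A i j\<bar> \<le> C"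
  shows "(\<Sum>i<N. (cmod (seq_apply A (ell2_nth f) i))\<^sup>2) \<le> (3 * C * norm f)\<^sup>2"
proof -
  let ?y = "\<lambda>i. cmod (ell2_nth f i)"
  let ?p = "\<lambda>i. if i = 0 then 0 else ?y (i - 1)"
  have "0 \<le> C" using C[of 0 0] by (meson abs_ge_zero order_trans)
  have sq3: "(a + b + c)\<^sup>2 \<le> 3 * (a\<^sup>2 + b\<^sup>2 + c\<^sup>2)" for a b c :: real
    using zero_le_power2[of "a - b"] zero_le_power2[of "a - c"] zero_le_power2[of "b - c"]
    by (simp add: power2_eq_square algebra_simps)
  have pt: "(cmod (seq_apply A (ell2_nth f) i))\<^sup>2 \<le> 3 * C\<^sup>2 * ((?y i)\<^sup>2 + (?y (Suc i))\<^sup>2 + (?p i)\<^sup>2)" for i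
  proof -
    have b: "cmod (of_real (A i j) * ell2_nth f j) \<le> C * ?y j" for j
      using C[of i j] by (simp add: norm_mult mult_right_mono)
    have "cmod (seq_apply A (ell2_nth f) i) \<le> C * ?y i + C * ?y (Suc i) + C * ?p i"
      unfolding seq_apply_three[OF A]
      by (intro order_trans[OF norm_triangle_ineq] add_mono order_refl b) (use b[of "i - 1"] in auto)
    also have "\<dots> = C * (?y i + ?y (Suc i) + ?p i)" by (simp add: algebra_simps)
    finally have "(cmod (seq_apply A (ell2_nth f) i))\<^sup>2 \<le> (C * (?y i + ?y (Suc i) + ?p i))\<^sup>2"
      by (intro power_mono) auto
    also have "\<dots> \<le> C\<^sup>2 * (3 * ((?y i)\<^sup>2 + (?y (Suc i))\<^sup>2 + (?p i)\<^sup>2))"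
      unfolding power_mult_distrib by (intro mult_left_mono sq3) auto
    finally show ?thesis by (simp add: algebra_simps)
  qed
  have s1: "(\<Sum>i<N. (?y i)\<^sup>2) \<le> (norm f)\<^sup>2"
    by (rule sum_le_norm_ell2) simp
  have s2: "(\<Sum>i<N. (?y (Suc i))\<^sup>2) \<le> (norm f)\<^sup>2"
  proof -
    have "(\<Sum>i<N. (?y (Suc i))\<^sup>2) = (\<Sum>i\<in>Suc ` {..<N}. (?y i)\<^sup>2)"
      by (subst sum.reindex) auto
    also have "\<dots> \<le> (norm f)\<^sup>2" by (rule sum_le_norm_ell2) simp
    finally show ?thesis .
  qed
  have s3: "(\<Sum>i<N. (?p i)\<^sup>2) \<le> (norm f)\<^sup>2"
  proof (cases N)
    case (Suc M)
    have "(\<Sum>i<N. (?p i)\<^sup>2) = (\<Sum>i<M. (?y i)\<^sup>2)"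
      unfolding Suc sum.lessThan_Suc_shift by simp
    then show ?thesis using sum_le_norm_ell2[of "{..<M}" f] by simp
  qed simp
  have "(\<Sum>i<N. (cmod (seq_apply A (ell2_nth f) i))\<^sup>2)
      \<le> (\<Sum>i<N. 3 * C\<^sup>2 * ((?y i)\<^sup>2 + (?y (Suc i))\<^sup>2 + (?p i)\<^sup>2))"
    by (intro sum_mono pt)
  also have "\<dots> = 3 * C\<^sup>2 * ((\<Sum>i<N. (?y i)\<^sup>2) + (\<Sum>i<N. (?y (Suc i))\<^sup>2) + (\<Sum>i<N. (?p i)\<^sup>2))"
    by (simp only: sum_distrib_left[symmetric] sum.distrib)
  also have "\<dots> \<le> 3 * C\<^sup>2 * ((norm f)\<^sup>2 + (norm f)\<^sup>2 + (norm f)\<^sup>2)"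
    by (intro mult_left_mono add_mono s1 s2 s3) auto
  finally show ?thesis by (simp add: power_mult_distrib)
qed

lemma ell2_nth_mat_apply:
  assumes "tridiagonal A" "bounded_matrix A \<or> finitely_supported f"
  shows "ell2_nth (mat_apply A f) = seq_apply A (ell2_nth f)"
  using assms(2)
proof
  assume "bounded_matrix A"
  then obtain C where "\<And>i j. \<bar>A i j\<bar> \<le> C" unfolding bounded_matrix_def by blast
  from ell2_nth_Abs[OF seq_apply_bound[OF assms(1) this]] show ?thesis
    unfolding mat_apply_eq .
next
  assume "finitely_supported f"
  then show ?thesis
    using mat_apply_tridiagonal(1)[OF assms(1)] by (auto simp: seq_apply_def)
qed

lemma bounded_linear_mat_apply:
  assumes A: "tridiagonal A" "bounded_matrix A"
  shows "bounded_linear (mat_apply A)"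
proof -
  obtain C where C: "\<And>i j. \<bar>A i j\<bar> \<le> C"
    using A(2) unfolding bounded_matrix_def by blast
  have nth: "ell2_nth (mat_apply A f) = seq_apply A (ell2_nth f)" for f
    using A by (intro ell2_nth_mat_apply) auto
  have "0 \<le> C" using C[of 0 0] by (meson abs_ge_zero order_trans)
  show ?thesis
  proof (rule bounded_linear_intro[where K = "3 * C"])
    fix f
    have "norm (mat_apply A f) \<le> 3 * C * norm f"
      using \<open>0 \<le> C\<close>
      by (intro norm_ell2_le) (auto simp: nth intro!: seq_apply_bound A C)
    then show "norm (mat_apply A f) \<le> norm f * (3 * C)" by (simp add: mult_ac)
  qed (auto intro!: ell2_eqI simp: nth seq_apply_three[OF A(1)] algebra_simps)
qed

lemma mat_apply_scaleC:
  assumes "tridiagonal A" "bounded_matrix A"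
  shows "mat_apply A (c *\<^sub>C f) = c *\<^sub>C mat_apply A f"
  using assms by (intro ell2_eqI) (simp add: ell2_nth_mat_apply seq_apply_three algebra_simps)

lemma mat_apply_diff:
  assumes "tridiagonal A" "finitely_supported f" "finitely_supported g" "finitely_supported (f - g)"
  shows "mat_apply A (f - g) = mat_apply A f - mat_apply A g"
  using assms by (intro ell2_eqI) (simp add: ell2_nth_mat_apply seq_apply_three algebra_simps)

lemma finitely_supported_diff:
  assumes "finitely_supported f" "finitely_supported g"
  shows "finitely_supported (f - g)"
  using assms unfolding finitely_supported_def
  by (rule_tac finite_subset[of _ "{k. ell2_nth f k \<noteq> 0} \<union> {k. ell2_nth g k \<noteq> 0}"]) auto

lemma finitely_supported_bound:
  assumes "finitely_supported f"
  obtains N where "\<And>n k. N \<le> n \<Longrightarrow> n \<le> k \<Longrightarrow> ell2_nth f k = 0"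
proof -
  obtain N where "\<And>k. ell2_nth f k \<noteq> 0 \<Longrightarrow> k < N"
    using assms unfolding finitely_supported_def finite_nat_set_iff_bounded by blast
  then show ?thesis by (intro that[of N]) (meson not_less order_trans)
qed

lemma cinner_mat_apply:
  assumes A: "tridiagonal A" and f: "finitely_supported f" and g: "finitely_supported g"
  shows "cinner (mat_apply A f) g = cinner f (mat_apply (transp_mat A) g)"
proof -
  obtain N1 N2 where N: "\<And>n k. N1 \<le> n \<Longrightarrow> n \<le> k \<Longrightarrow> ell2_nth f k = 0"
      "\<And>n k. N2 \<le> n \<Longrightarrow> n \<le> k \<Longrightarrow> ell2_nth g k = 0"
    using finitely_supported_bound[OF f] finitely_supported_bound[OF g] by metis
  define N where "N = max N1 N2"
  have fz: "ell2_nth f k = 0" and gz: "ell2_nth g k = 0" if "N \<le> k" for k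
    using N[of N k] that by (auto simp: N_def)
  have At: "tridiagonal (transp_mat A)"
    using A unfolding tridiagonal_def transp_mat_def by blast
  have ap: "seq_apply B (ell2_nth h) i = (\<Sum>j<N. of_real (B i j) * ell2_nth h j)"
    if "\<And>k. N \<le> k \<Longrightarrow> ell2_nth h k = 0" for B h i
    unfolding seq_apply_def using that by (intro suminf_finite) (auto simp: not_less)
  have apf: "seq_apply B (ell2_nth f) i = (\<Sum>j<N. of_real (B i j) * ell2_nth f j)"
    and apg: "seq_apply B (ell2_nth g) i = (\<Sum>j<N. of_real (B i j) * ell2_nth g j)" for B i
    by (rule ap, erule fz, rule ap, erule gz)
  have "cinner (mat_apply A f) g = (\<Sum>i<N. seq_apply A (ell2_nth f) i * cnj (ell2_nth g i))"
    unfolding cinner.rep_eq using ell2_nth_mat_apply[OF A] f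
    by (subst suminf_finite[of "{..<N}"]) (auto simp: gz)
  also have "\<dots> = (\<Sum>j<N. ell2_nth f j * cnj (seq_apply (transp_mat A) (ell2_nth g) j))"
    unfolding apf apg sum_distrib_right sum_distrib_left cnj_sum
    by (subst sum.swap) (simp add: transp_mat_def mult_ac)
  also have "\<dots> = cinner f (mat_apply (transp_mat A) g)"
    unfolding cinner.rep_eq using ell2_nth_mat_apply[OF At] g
    by (subst suminf_finite[of "{..<N}"]) (auto simp: fz)
  finally show ?thesis .
qed

lemma tridiagonal_transp_mat: "tridiagonal A \<Longrightarrow> tridiagonal (transp_mat A)"
  unfolding tridiagonal_def transp_mat_def by blast

lemma bounded_matrix_transp_mat: "bounded_matrix A \<Longrightarrow> bounded_matrix (transp_mat A)"
  unfolding bounded_matrix_def transp_mat_def by blast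

text \<open>Both sides are continuous in \<open>f\<close> and \<open>g\<close>, and truncations are
  dense.\<close>

lemma cinner_mat_apply_bounded:
  assumes A: "tridiagonal A" "bounded_matrix A"
  shows "cinner (mat_apply A f) g = cinner f (mat_apply (transp_mat A) g)"
proof -
  note lim = bounded_linear.tendsto[OF bounded_linear_mat_apply ell2_truncate_tendsto]
  have "(\<lambda>n. cinner (mat_apply A (ell2_truncate n f)) (ell2_truncate n g)) \<longlonglongrightarrow> cinner (mat_apply A f) g"
    by (intro tendsto_cinner lim A ell2_truncate_tendsto)
  moreover have "(\<lambda>n. cinner (mat_apply A (ell2_truncate n f)) (ell2_truncate n g))
      \<longlonglongrightarrow> cinner f (mat_apply (transp_mat A) g)"
    unfolding cinner_mat_apply[OF A(1) finitely_supported_truncate finitely_supported_truncate]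
    by (intro tendsto_cinner lim tridiagonal_transp_mat bounded_matrix_transp_mat A ell2_truncate_tendsto)
  ultimately show ?thesis by (rule LIMSEQ_unique)
qed

section \<open>Closures of matrices acting on finitely supported sequences\<close>

lemma generated_operator_iff:
  "p \<in> generated_operator A \<longleftrightarrow>
     (\<exists>u. (\<forall>n. finitely_supported (u n)) \<and> (\<lambda>n. (u n, mat_apply A (u n))) \<longlonglongrightarrow> p)"
proof
  assume "p \<in> generated_operator A"
  then obtain q where q: "\<forall>n. q n \<in> {(f, mat_apply A f) | f. finitely_supported f}" "q \<longlonglongrightarrow> p"
    unfolding generated_operator_def closure_sequential by (elim exE conjE)
  have "\<forall>n. \<exists>f. finitely_supported f \<and> q n = (f, mat_apply A f)"
    using q(1) by auto
  then obtain u where u: "\<And>n. finitely_supported (u n)" "\<And>n. q n = (u n, mat_apply A (u n))"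
    by metis
  have "q = (\<lambda>n. (u n, mat_apply A (u n)))" using u(2) by (rule ext)
  then show "\<exists>u. (\<forall>n. finitely_supported (u n)) \<and> (\<lambda>n. (u n, mat_apply A (u n))) \<longlonglongrightarrow> p"
    using u(1) q(2) by (intro exI[of _ u]) simp
next
  assume "\<exists>u. (\<forall>n. finitely_supported (u n)) \<and> (\<lambda>n. (u n, mat_apply A (u n))) \<longlonglongrightarrow> p"
  then obtain u where u: "\<forall>n. finitely_supported (u n)" "(\<lambda>n. (u n, mat_apply A (u n))) \<longlonglongrightarrow> p"
    by (elim exE conjE)
  then show "p \<in> generated_operator A"
    unfolding generated_operator_def closure_sequential
    by (intro exI[of _ "\<lambda>n. (u n, mat_apply A (u n))"]) auto
qed

text \<open>The graph of a bounded \<open>S\<close> is closed, so the closure stays inside it, and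
  truncations reach each of its points.\<close>

lemma generated_operator_bounded:
  assumes S: "bounded_linear S" and eq: "\<And>f. finitely_supported f \<Longrightarrow> mat_apply A f = S f"
  shows "generated_operator A = range (\<lambda>f. (f, S f))"
proof (intro set_eqI iffI)
  fix p assume "p \<in> generated_operator A"
  then obtain u where u: "\<forall>n. finitely_supported (u n)" "(\<lambda>n. (u n, mat_apply A (u n))) \<longlonglongrightarrow> p"
    unfolding generated_operator_iff by (elim exE conjE)
  have "(\<lambda>n. u n) \<longlonglongrightarrow> fst p" "(\<lambda>n. S (u n)) \<longlonglongrightarrow> snd p"
    using tendsto_fst[OF u(2)] tendsto_snd[OF u(2)] by (simp_all add: eq[OF u(1)[rule_format]])
  moreover have "(\<lambda>n. S (u n)) \<longlonglongrightarrow> S (fst p)"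
    by (rule bounded_linear.tendsto[OF S]) fact
  ultimately have "snd p = S (fst p)"
    using LIMSEQ_unique by blast
  then show "p \<in> range (\<lambda>f. (f, S f))"
    by (intro image_eqI[of _ _ "fst p"]) (simp_all add: prod_eq_iff)
next
  fix p assume "p \<in> range (\<lambda>f. (f, S f))"
  then obtain f where p: "p = (f, S f)" by (elim rangeE)
  have "(\<lambda>n. (ell2_truncate n f, mat_apply A (ell2_truncate n f))) \<longlonglongrightarrow> p"
    unfolding p eq[OF finitely_supported_truncate]
    by (rule tendsto_Pair[OF ell2_truncate_tendsto bounded_linear.tendsto[OF S ell2_truncate_tendsto]])
  then show "p \<in> generated_operator A"
    unfolding generated_operator_iff
    by (intro exI[of _ "\<lambda>n. ell2_truncate n f"]) (simp add: finitely_supported_truncate)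
qed

text \<open>A row involves finitely many coordinates, so limits can be taken coordinatewise even
  when \<open>A\<close> is unbounded.\<close>

lemma seq_apply_tendsto:
  assumes "tridiagonal A" "u \<longlonglongrightarrow> f"
  shows "(\<lambda>n. seq_apply A (ell2_nth (u n)) i) \<longlonglongrightarrow> seq_apply A (ell2_nth f) i"
  unfolding seq_apply_tridiagonal[OF assms(1) order_refl]
  by (intro tendsto_intros tendsto_ell2_nth assms(2))

lemma signature_tridiagonal: "signature_matrix G \<Longrightarrow> tridiagonal G"
  unfolding signature_matrix_def tridiagonal_def by (metis le_SucI order_refl)

lemma signature_bounded: "signature_matrix G \<Longrightarrow> bounded_matrix G"
proof -
  assume "signature_matrix G"
  then have "\<bar>G i j\<bar> \<le> 1" for i j
    unfolding signature_matrix_def by (cases "i = j") (metis abs_1 abs_minus order_refl, simp)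
  then show ?thesis unfolding bounded_matrix_def by blast
qed

lemma lower_bidiagonal_tridiagonal: "lower_bidiagonal L \<Longrightarrow> tridiagonal L"
  unfolding lower_bidiagonal_def tridiagonal_def by (metis le_SucI order_refl)

lemma signature_mat_mult:
  assumes "signature_matrix G"
  shows "(A \<odot> G) i j = A i j * G j j" "(G \<odot> A) i j = G i i * A i j"
proof -
  have "(A \<odot> G) i j = (\<Sum>k\<in>{j}. A i k * G k j)"
    unfolding mat_mult_def using assms by (intro suminf_finite) (auto simp: signature_matrix_def)
  then show "(A \<odot> G) i j = A i j * G j j" by simp
  have "(G \<odot> A) i j = (\<Sum>k\<in>{i}. G i k * A k j)"
    unfolding mat_mult_def using assms by (intro suminf_finite) (auto simp: signature_matrix_def)
  then show "(G \<odot> A) i j = G i i * A i j" by simp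
qed

lemma tridiagonal_add_id: "tridiagonal A \<Longrightarrow> tridiagonal (\<lambda>i j. A i j + c * id_mat i j)"
  unfolding tridiagonal_def id_mat_def by auto

lemma seq_apply_add_id:
  "tridiagonal A \<Longrightarrow> seq_apply (\<lambda>i j. A i j + c * id_mat i j) y i = seq_apply A y i + of_real c * y i"
  using tridiagonal_add_id[of A c] by (auto simp: seq_apply_three id_mat_def algebra_simps)

section \<open>The shifted Darboux transformation\<close>

locale darboux =
  fixes J L G :: smatrix and x :: real
  assumes tridiagonal_J: "tridiagonal J" and LGL: "LGL_factorization J x L G"
begin

abbreviation "T \<equiv> shifted_darboux x L G"
abbreviation "L' \<equiv> transp_mat L"

lemma sig: "signature_matrix G" and bidiag: "lower_bidiagonal L"
  and J_eq: "J = (\<lambda>i j. (L \<odot> G \<odot> L') i j + x * id_mat i j)"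
  and L_pos: "L i i > 0"
  using LGL unfolding LGL_factorization_def by (auto simp: fun_eq_iff algebra_simps)

lemmas tri_G = signature_tridiagonal[OF sig]
lemmas bdd_G = signature_bounded[OF sig]
lemmas tri_L = lower_bidiagonal_tridiagonal[OF bidiag]
lemmas tri_L' = tridiagonal_transp_mat[OF tri_L]

lemma tri_LGL: "tridiagonal (L \<odot> G \<odot> L')"
proof -
  have "(L \<odot> G \<odot> L') = (\<lambda>i j. J i j + (- x) * id_mat i j)"
    by (simp add: J_eq)
  then show ?thesis
    using tridiagonal_add_id[OF tridiagonal_J, of "- x"] by simp
qed

text \<open>Columns \<open>i\<close> and \<open>j\<close> of a lower bidiagonal matrix share a row
  only if the indices differ by at most one.\<close>

lemma tri_GL'L: "tridiagonal (G \<odot> L' \<odot> L)"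
proof -
  have entry: "(G \<odot> L' \<odot> L) i j = (\<Sum>k. G i i * L k i * L k j)" for i j
    unfolding mat_mult_def[of "G \<odot> L'" L] signature_mat_mult[OF sig] by (simp add: transp_mat_def)
  have zero: "G i i * L k i * L k j = 0" if "Suc j < i \<or> Suc i < j" for i j k
  proof (rule ccontr)
    assume "G i i * L k i * L k j \<noteq> 0"
    then have "k = i \<or> k = Suc i" "k = j \<or> k = Suc j"
      using bidiag unfolding lower_bidiagonal_def by auto
    with that show False by auto
  qed
  have "(G \<odot> L' \<odot> L) i j = 0" if "Suc j < i \<or> Suc i < j" for i j
    unfolding entry by (simp only: zero[OF that] suminf_zero)
  then show ?thesis
    unfolding tridiagonal_def by (meson not_less)
qed

lemma tridiagonal_T: "tridiagonal T"
  unfolding shifted_darboux_def by (rule tridiagonal_add_id[OF tri_GL'L])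

lemma seq_apply_J:
  "seq_apply J y i = seq_apply L (seq_apply G (seq_apply L' y)) i + of_real x * y i"
proof -
  have "tridiagonal (L \<odot> G)"
    using tri_L unfolding tridiagonal_def signature_mat_mult[OF sig] by simp
  then have "seq_apply (L \<odot> G \<odot> L') y i = seq_apply L (seq_apply G (seq_apply L' y)) i"
    by (simp add: seq_apply_mult tri_L tri_G tri_L')
  then show ?thesis
    by (subst J_eq) (simp add: seq_apply_add_id tri_LGL)
qed

lemma seq_apply_T:
  "seq_apply T y i = seq_apply G (seq_apply L' (seq_apply L y)) i + of_real x * y i"
proof -
  have "tridiagonal (G \<odot> L')"
    using tri_L' unfolding tridiagonal_def signature_mat_mult[OF sig] by simp
  then have "seq_apply (G \<odot> L' \<odot> L) y i = seq_apply G (seq_apply L' (seq_apply L y)) i"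
    by (simp add: seq_apply_mult tri_L tri_G tri_L')
  then show ?thesis
    by (simp add: shifted_darboux_def seq_apply_add_id tri_GL'L)
qed

text \<open>\<open>mat_apply\<close> is faithful either because the matrix is bounded or because the
  vector is finitely supported. Each factor passes this disjunction on to the next, so one proof of
  each factorization serves both regimes.\<close>

lemma mat_apply_cases:
  assumes "bounded_matrix L \<or> finitely_supported f"
  shows "ell2_nth (mat_apply L f) = seq_apply L (ell2_nth f)"
    "ell2_nth (mat_apply L' f) = seq_apply L' (ell2_nth f)"
    "bounded_matrix L \<or> finitely_supported (mat_apply L f)"
    "bounded_matrix L \<or> finitely_supported (mat_apply L' f)"
    "bounded_matrix L \<or> finitely_supported (mat_apply G f)"
  using assms bounded_matrix_transp_mat
  by (auto intro!: ell2_nth_mat_apply tri_L tri_L' mat_apply_tridiagonal tri_G)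

lemma nth_G: "ell2_nth (mat_apply G f) = seq_apply G (ell2_nth f)"
  by (rule ell2_nth_mat_apply) (simp_all add: tri_G bdd_G)

lemma mat_apply_J:
  assumes "bounded_matrix L \<or> finitely_supported f"
  shows "mat_apply J f = mat_apply L (mat_apply G (mat_apply L' f)) + x *\<^sub>R f"
proof -
  have "seq_apply J (ell2_nth f) = ell2_nth (mat_apply L (mat_apply G (mat_apply L' f)) + x *\<^sub>R f)"
    by (simp add: fun_eq_iff seq_apply_J nth_G mat_apply_cases assms)
  then show ?thesis
    unfolding mat_apply_eq[of J] by (simp only: ell2_nth_inverse)
qed

lemma mat_apply_T:
  assumes "bounded_matrix L \<or> finitely_supported f"
  shows "mat_apply T f = mat_apply G (mat_apply L' (mat_apply L f)) + x *\<^sub>R f"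
proof -
  have "seq_apply T (ell2_nth f) = ell2_nth (mat_apply G (mat_apply L' (mat_apply L f)) + x *\<^sub>R f)"
    by (simp add: fun_eq_iff seq_apply_T nth_G mat_apply_cases assms)
  then show ?thesis
    unfolding mat_apply_eq[of T] by (simp only: ell2_nth_inverse)
qed

lemma mat_apply_G_G: "mat_apply G (mat_apply G f) = f"
proof (rule ell2_eqI)
  fix i
  have "G i i * G i i = 1"
    using sig unfolding signature_matrix_def by (metis mult_1 minus_mult_minus)
  then show "ell2_nth (mat_apply G (mat_apply G f)) i = ell2_nth f i"
    by (simp add: mat_apply_signature[OF sig] mult.assoc[symmetric] of_real_mult[symmetric] del: of_real_mult)
qed

lemma transp_G: "transp_mat G = G"
  using sig unfolding signature_matrix_def transp_mat_def by (metis ext)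

lemma cinner_G: "cinner (mat_apply G f) g = cinner f (mat_apply G g)"
  using cinner_mat_apply_bounded[OF tri_G bdd_G] by (simp add: transp_G)

text \<open>The outer \<open>G\<close> undoes the leading \<open>G\<close> of T - x, since G^2 = I,
  and leaves L^T L. Phrased through \<open>T\<close>, the right side has a limit whenever
  \<open>g\<close> converges in the graph of the closure.\<close>

lemma cinner_L_L:
  assumes "finitely_supported f" "finitely_supported g"
  shows "cinner (mat_apply L f) (mat_apply L g) = cinner f (mat_apply G (mat_apply T g - x *\<^sub>R g))"
  using assms by (simp add: cinner_mat_apply tri_L mat_apply_tridiagonal(2) mat_apply_T mat_apply_G_G)

text \<open>The intertwining (L G L^T + x) L = L (G L^T L + x).\<close>

lemma mat_apply_J_L:
  assumes "finitely_supported f"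
  shows "mat_apply J (mat_apply L f) = mat_apply L (mat_apply T f)"
proof (rule ell2_eqI)
  fix i
  have T: "ell2_nth (mat_apply T f) = seq_apply T (ell2_nth f)" "finitely_supported (mat_apply T f)"
    using assms by (auto intro!: ell2_nth_mat_apply mat_apply_tridiagonal tridiagonal_T)
  show "ell2_nth (mat_apply J (mat_apply L f)) i = ell2_nth (mat_apply L (mat_apply T f)) i"
    unfolding ell2_nth_mat_apply[OF tridiagonal_J disjI2[OF mat_apply_tridiagonal(2)[OF tri_L assms]]]
      ell2_nth_mat_apply[OF tri_L disjI2[OF T(2)]] ell2_nth_mat_apply[OF tri_L disjI2[OF assms]] T(1)
    unfolding seq_apply_J
    by (simp add: seq_apply_three[OF tri_L] seq_apply_T algebra_simps)
qed

text \<open>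
  The quadratic form of \<open>G (T - x)\<close> is \<open>\<parallel>L u\<parallel>\<^sup>2\<close>, so \<open>L u\<close> is square summable for every \<open>u\<close> in the
  domain of \<open>T\<close>. For \<open>u = (T - z)\<inverse> e\<^sub>k\<close> the vector \<open>y = L u\<close> solves \<open>(J - z) y = L e\<^sub>k\<close>, and taking
  imaginary parts of \<open>(L e\<^sub>k, y) = (e\<^sub>k, G (T - x) u)\<close> bounds \<open>y\<close>, hence column \<open>k\<close> of \<open>L\<close>.
\<close>

lemma nonreal_resolvent_imp_bounded_L:
  assumes z: "z \<in> resolvent_set (generated_operator T)" "Im z \<noteq> 0" and J: "bounded_matrix J"
    and J_sym: "\<And>i j. J i j = J j i"
  shows "bounded_matrix L"
proof -
  obtain R where R: "bounded_linear R" "\<And>h. (R h, h + z *\<^sub>C R h) \<in> generated_operator T"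
    using z(1) unfolding resolvent_set_iff by (elim exE conjE) simp
  obtain K where K: "0 < K" "\<And>h. norm (R h) \<le> norm h * K"
    using bounded_linear.pos_bounded[OF R(1)] by blast
  obtain KJ where KJ: "0 < KJ" "\<And>h. norm (mat_apply J h) \<le> norm h * KJ"
    using bounded_linear.pos_bounded[OF bounded_linear_mat_apply[OF tridiagonal_J J]] by blast
  obtain KG where KG: "0 < KG" "\<And>h. norm (mat_apply G h) \<le> norm h * KG"
    using bounded_linear.pos_bounded[OF bounded_linear_mat_apply[OF tri_G bdd_G]] by blast
  have Jt: "transp_mat J = J"
    unfolding transp_mat_def using J_sym by (metis ext)
  \<comment> \<open>\<open>C\<close> bounds G (T - x) u for u = (T - z)^-1 e_k, because (T - x) u =
    e_k + (z - x) u. \<open>D\<close> comes from L e_k = (J - z) y, where the squared norm of y is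
    at most \<open>C / \<bar>Im z\<bar>\<close>.\<close>
  define C where "C = (1 + cmod (z - of_real x) * K) * KG"
  define D where "D = sqrt ((KJ + cmod z)\<^sup>2 * (C / \<bar>Im z\<bar>))"
  have "norm (mat_apply L (ell2_unit k)) \<le> D" for k
  proof -
    let ?e = "ell2_unit k"
    define v where "v = R ?e"
    have nv: "norm v \<le> K" using K(2)[of ?e] by (simp add: v_def)
    from R(2)[of ?e] obtain u where u: "\<forall>n. finitely_supported (u n)"
        "(\<lambda>n. (u n, mat_apply T (u n))) \<longlonglongrightarrow> (v, ?e + z *\<^sub>C v)"
      unfolding generated_operator_iff v_def by (elim exE conjE)
    note fs = u(1)[rule_format]
    have u1: "u \<longlonglongrightarrow> v" and u2: "(\<lambda>n. mat_apply T (u n)) \<longlonglongrightarrow> ?e + z *\<^sub>C v"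
      using tendsto_fst[OF u(2)] tendsto_snd[OF u(2)] by simp_all
    define w where "w n = mat_apply G (mat_apply T (u n) - x *\<^sub>R u n)" for n
    define w0 where "w0 = mat_apply G (?e + z *\<^sub>C v - x *\<^sub>R v)"
    have w: "w \<longlonglongrightarrow> w0"
      unfolding w_def w0_def
      by (intro bounded_linear.tendsto[OF bounded_linear_mat_apply[OF tri_G bdd_G]] tendsto_diff u2 tendsto_scaleR tendsto_const u1)
    \<comment> \<open>The closure supplies convergence of \<open>u n\<close> and of \<open>T\<close>
      applied to it, nothing more; the form converts this into convergence of the images under
      \<open>L\<close>.\<close>
    have Lsq: "(norm (mat_apply L (u n) - mat_apply L (u m)))\<^sup>2 = Re (cinner (u n - u m) (w n - w m))" for n m
    proof -
      have f: "finitely_supported (u n - u m)"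
        by (intro finitely_supported_diff fs)
      have "mat_apply G (mat_apply T (u n - u m) - x *\<^sub>R (u n - u m)) = w n - w m"
      proof -
        interpret GG: bounded_linear "mat_apply G"
          by (rule bounded_linear_mat_apply[OF tri_G bdd_G])
        show ?thesis
          unfolding w_def mat_apply_diff[OF tridiagonal_T fs fs f] GG.diff[symmetric]
          by (simp add: algebra_simps)
      qed
      then have "cinner (mat_apply L (u n - u m)) (mat_apply L (u n - u m)) = cinner (u n - u m) (w n - w m)"
        by (simp add: cinner_L_L f)
      then show ?thesis
        unfolding cinner_self_norm mat_apply_diff[OF tri_L fs fs f] by (metis Re_complex_of_real)
    qed
    have "Cauchy (\<lambda>n. mat_apply L (u n))"
      unfolding Cauchy_iff
    proof (intro allI impI)
      fix e :: real assume e: "0 < e"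
      obtain B where B: "0 < B" "\<And>n. norm (w n) \<le> B"
        using convergent_imp_Bseq[OF convergentI[OF w]] unfolding Bseq_def by blast
      \<comment> \<open>By Cauchy-Schwarz the squared distance of the images is at most
        \<open>norm (u m - u n)\<close> times \<open>2 * B\<close>, hence this threshold.\<close>
      obtain M where M: "\<And>m n. M \<le> m \<Longrightarrow> M \<le> n \<Longrightarrow> norm (u m - u n) < e\<^sup>2 / (2 * B)"
        using LIMSEQ_imp_Cauchy[OF u1] e B(1) unfolding Cauchy_iff
        by (meson divide_pos_pos mult_pos_pos zero_less_numeral zero_less_power)
      have "norm (mat_apply L (u m) - mat_apply L (u n)) < e" if "M \<le> m" "M \<le> n" for m n
      proof -
        have "(norm (mat_apply L (u m) - mat_apply L (u n)))\<^sup>2 \<le> norm (u m - u n) * norm (w m - w n)"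
          unfolding Lsq using abs_Re_le_cmod cmod_cinner_le by (meson abs_le_D1 order_trans)
        also have "\<dots> \<le> norm (u m - u n) * (2 * B)"
          using norm_triangle_ineq4[of "w m" "w n"] B(2)[of m] B(2)[of n] by (intro mult_left_mono) auto
        also have "\<dots> < e\<^sup>2"
          using M[OF that] B(1) by (simp add: field_simps)
        finally show ?thesis
          using e by (meson less_imp_le power_less_imp_less_base)
      qed
      then show "\<exists>M. \<forall>m\<ge>M. \<forall>n\<ge>M. norm (mat_apply L (u m) - mat_apply L (u n)) < e"
        by blast
    qed
    then obtain y where y: "(\<lambda>n. mat_apply L (u n)) \<longlonglongrightarrow> y"
      using Cauchy_convergent convergent_def by blast
    have nthL: "ell2_nth (mat_apply L f) = seq_apply L (ell2_nth f)" if "finitely_supported f" for f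
      using that by (intro ell2_nth_mat_apply tri_L) simp
    have y_nth: "ell2_nth y i = seq_apply L (ell2_nth v) i" for i
    proof (rule LIMSEQ_unique)
      show "(\<lambda>n. seq_apply L (ell2_nth (u n)) i) \<longlonglongrightarrow> seq_apply L (ell2_nth v) i"
        by (rule seq_apply_tendsto[OF tri_L u1])
      show "(\<lambda>n. seq_apply L (ell2_nth (u n)) i) \<longlonglongrightarrow> ell2_nth y i"
        using tendsto_ell2_nth[OF y, of i] by (simp add: nthL[OF fs])
    qed
    \<comment> \<open>\<open>J\<close> is bounded and passes through the norm limit; on the other
      side \<open>L\<close> can only be followed coordinate by coordinate.\<close>
    have Jy: "mat_apply J y = mat_apply L ?e + z *\<^sub>C y"
    proof (rule ell2_eqI)
      fix i
      have "(\<lambda>n. ell2_nth (mat_apply J (mat_apply L (u n))) i) \<longlonglongrightarrow> ell2_nth (mat_apply J y) i"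
        by (intro tendsto_ell2_nth bounded_linear.tendsto[OF bounded_linear_mat_apply[OF tridiagonal_J J]] y)
      moreover have "ell2_nth (mat_apply J (mat_apply L (u n))) i = seq_apply L (ell2_nth (mat_apply T (u n))) i" for n
        unfolding mat_apply_J_L[OF fs] using nthL[OF mat_apply_tridiagonal(2)[OF tridiagonal_T fs]] by simp
      ultimately have "ell2_nth (mat_apply J y) i = seq_apply L (ell2_nth (?e + z *\<^sub>C v)) i"
        using seq_apply_tendsto[OF tri_L u2, of i] LIMSEQ_unique by simp
      then show "ell2_nth (mat_apply J y) i = ell2_nth (mat_apply L ?e + z *\<^sub>C y) i"
        by (simp add: nthL[OF finitely_supported_unit] y_nth seq_apply_three[OF tri_L] algebra_simps)
    qed
    have pair: "cinner (mat_apply L ?e) y = cinner ?e w0"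
    proof (rule LIMSEQ_unique)
      show "(\<lambda>n. cinner (mat_apply L ?e) (mat_apply L (u n))) \<longlonglongrightarrow> cinner (mat_apply L ?e) y"
        by (intro tendsto_cinner tendsto_const y)
      show "(\<lambda>n. cinner (mat_apply L ?e) (mat_apply L (u n))) \<longlonglongrightarrow> cinner ?e w0"
        unfolding cinner_L_L[OF finitely_supported_unit fs] w_def[symmetric]
        by (intro tendsto_cinner tendsto_const w)
    qed
    have "norm w0 \<le> C"
    proof -
      have "?e + z *\<^sub>C v - x *\<^sub>R v = ?e + (z - of_real x) *\<^sub>C v"
        by (simp add: scaleC_algebra)
      also have "norm \<dots> \<le> 1 + cmod (z - of_real x) * norm v"
        using norm_triangle_ineq[of ?e "(z - of_real x) *\<^sub>C v"] by (simp add: norm_scaleC)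
      finally have "norm (?e + z *\<^sub>C v - x *\<^sub>R v) \<le> 1 + cmod (z - of_real x) * norm v" .
      also have "\<dots> \<le> 1 + cmod (z - of_real x) * K"
        using nv by (simp add: mult_left_mono)
      finally show ?thesis
        unfolding w0_def C_def using KG(1) by (intro order_trans[OF KG(2)] mult_right_mono) auto
    qed
    then have pair_le: "cmod (cinner (mat_apply L ?e) y) \<le> C"
      unfolding pair using cmod_cinner_le[of ?e w0] by simp
    have "cinner (mat_apply J y) y = cinner y (mat_apply J y)"
      using cinner_mat_apply_bounded[OF tridiagonal_J J, of y y] unfolding Jt .
    also have "\<dots> = cnj (cinner (mat_apply J y) y)"
      by (rule cinner_commute)
    finally have "Im (cinner (mat_apply J y) y) = 0"
      by (simp add: complex_eq_iff)
    then have "Im (cinner (mat_apply L ?e) y) = - (Im z * (norm y)\<^sup>2)"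
      unfolding Jy cinner_add_left cinner_scaleC_left cinner_self_norm by simp
    then have "\<bar>Im z\<bar> * (norm y)\<^sup>2 \<le> C"
      using pair_le abs_Im_le_cmod[of "cinner (mat_apply L ?e) y"] by (simp add: abs_mult)
    then have y_le: "(norm y)\<^sup>2 \<le> C / \<bar>Im z\<bar>"
      using z(2) by (simp add: field_simps)
    have "mat_apply L ?e = mat_apply J y - z *\<^sub>C y" by (simp add: Jy)
    also have "norm \<dots> \<le> (KJ + cmod z) * norm y"
      using norm_triangle_ineq4[of "mat_apply J y" "z *\<^sub>C y"] KJ(2)[of y]
      by (simp add: norm_scaleC algebra_simps)
    finally have "norm (mat_apply L ?e) \<le> (KJ + cmod z) * norm y" .
    then have "(norm (mat_apply L ?e))\<^sup>2 \<le> ((KJ + cmod z) * norm y)\<^sup>2"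
      by (rule power_mono) simp
    also have "\<dots> \<le> (KJ + cmod z)\<^sup>2 * (C / \<bar>Im z\<bar>)"
      unfolding power_mult_distrib by (intro mult_left_mono y_le) simp
    finally show ?thesis
      unfolding D_def by (rule real_le_rsqrt)
  qed
  moreover have "\<bar>L i k\<bar> \<le> norm (mat_apply L (ell2_unit k))" for i k
  proof -
    have "ell2_nth (mat_apply L (ell2_unit k)) i = seq_apply L (ell2_nth (ell2_unit k)) i"
      by (simp add: ell2_nth_mat_apply tri_L finitely_supported_unit)
    also have "\<dots> = of_real (L i k)"
      unfolding seq_apply_def by (subst suminf_finite[of "{k}"]) (auto simp: ell2_unit.rep_eq)
    finally show ?thesis
      using cmod_ell2_nth_le[of "mat_apply L (ell2_unit k)" i] by simp
  qed
  ultimately show ?thesis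
    unfolding bounded_matrix_def by (meson order_trans)
qed

section \<open>Consequences of bounded entries of \<open>L\<close>\<close>

context
  assumes bdd_L: "bounded_matrix L"
begin

definition op_L where "op_L = mat_apply L"
definition op_GLt where "op_GLt f = mat_apply G (mat_apply L' f)"

lemmas bdd_L' = bounded_matrix_transp_mat[OF bdd_L]

lemma op_L: "bounded_linear op_L" "op_L (c *\<^sub>C f) = c *\<^sub>C op_L f"
  unfolding op_L_def by (intro bounded_linear_mat_apply mat_apply_scaleC tri_L bdd_L)+

lemma op_GLt: "bounded_linear op_GLt" "op_GLt (c *\<^sub>C f) = c *\<^sub>C op_GLt f"
  unfolding op_GLt_def
  by (intro bounded_linear_compose[OF bounded_linear_mat_apply[OF tri_G bdd_G]]
      bounded_linear_mat_apply tri_L' bdd_L')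
     (simp add: mat_apply_scaleC tri_L' bdd_L' tri_G bdd_G)

lemma bounded_linear_L_GLt: "bounded_linear (\<lambda>f. op_L (op_GLt f) + x *\<^sub>R f)"
  by (intro bounded_linear_add bounded_linear_compose[OF op_L(1)] op_GLt(1) bounded_linear_scaleR_right)

lemma bounded_linear_GLt_L: "bounded_linear (\<lambda>f. op_GLt (op_L f) + x *\<^sub>R f)"
  by (intro bounded_linear_add bounded_linear_compose[OF op_GLt(1)] op_L(1) bounded_linear_scaleR_right)

lemma generated_J: "generated_operator J = range (\<lambda>f. (f, op_L (op_GLt f) + x *\<^sub>R f))"
  by (rule generated_operator_bounded[OF bounded_linear_L_GLt]) (simp add: op_L_def op_GLt_def mat_apply_J)

lemma generated_T: "generated_operator T = range (\<lambda>f. (f, op_GLt (op_L f) + x *\<^sub>R f))"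
  by (rule generated_operator_bounded[OF bounded_linear_GLt_L]) (simp add: op_L_def op_GLt_def mat_apply_T)

lemma bounded_L_imp_spectrum_eq:
  "spectrum (generated_operator T) - {of_real x} = spectrum (generated_operator J) - {of_real x}"
  unfolding spectrum_def generated_J generated_T
  using resolvent_set_swap[OF op_L op_GLt, of _ x] resolvent_set_swap[OF op_GLt op_L, of _ x] by blast

lemma bounded_L_imp_definitizable: "definitizable G (generated_operator T)"
proof -
  let ?S = "\<lambda>f. op_GLt (op_L f) + x *\<^sub>R f"
  interpret GG: bounded_linear "mat_apply G"
    by (rule bounded_linear_mat_apply[OF tri_G bdd_G])
  have GB: "mat_apply G (op_GLt (op_L f)) = mat_apply L' (mat_apply L f)" for f
    by (simp add: op_L_def op_GLt_def mat_apply_G_G)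
  have LL: "cinner (mat_apply L' (mat_apply L f)) g = cinner (mat_apply L f) (mat_apply L g)" for f g
    using cinner_mat_apply_bounded[OF tri_L' bdd_L'] by (simp add: transp_mat_def[abs_def])
  have LL': "cinner f (mat_apply L' (mat_apply L g)) = cinner (mat_apply L f) (mat_apply L g)" for f g
    by (subst cinner_commute) (simp only: LL cinner_commute[symmetric])
  have "{(f, mat_apply G g) | f g. (f, g) \<in> generated_operator T} = range (\<lambda>f. (f, mat_apply G (?S f)))"
    unfolding generated_T by auto
  moreover have "selfadjoint_op (range (\<lambda>f. (f, mat_apply G (?S f))))"
    by (rule selfadjoint_op_graph)
       (simp add: GG.add GG.scaleR GB LL LL' cinner_add_left cinner_add_right cinner_G
         bounded_bilinear.scaleR_left[OF bounded_bilinear_cinner]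
         bounded_bilinear.scaleR_right[OF bounded_bilinear_cinner])
  ultimately have "krein_selfadjoint G (generated_operator T)"
    unfolding krein_selfadjoint_def by simp
  moreover have "resolvent_set (generated_operator T) \<noteq> {}"
  proof -
    obtain K where K: "0 < K" "\<And>h. norm (?S h) \<le> norm h * K"
      using bounded_linear.pos_bounded[OF bounded_linear_GLt_L] by blast
    have "of_real (K + 1) \<in> resolvent_set (generated_operator T)"
      unfolding generated_T using K(1)
      by (intro resolvent_set_bounded_graph[OF bounded_linear_GLt_L K(2)]) (auto simp del: of_real_add)
    then show ?thesis by blast
  qed
  moreover have "\<exists>g. (f, g) \<in> poly_op [:- x, 1:] (generated_operator T) \<and> krein_inner G g f \<in> \<real>\<^sub>\<ge>\<^sub>0" for f
  proof (intro exI[of _ "op_GLt (op_L f)"] conjI)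
    define u where "u k = (if k = 0 then f else ?S f)" for k :: nat
    have "\<forall>k\<le>degree [:- x, 1:]. (f, u k) \<in> generated_operator T ^^ k"
      by (auto simp: u_def generated_T le_Suc_eq)
    moreover have "(\<Sum>k\<le>degree [:- x, 1:]. coeff [:- x, 1:] k *\<^sub>R u k) = op_GLt (op_L f)"
      by (simp add: u_def)
    ultimately show "(f, op_GLt (op_L f)) \<in> poly_op [:- x, 1:] (generated_operator T)"
      unfolding poly_op_def by (intro CollectI exI[of _ f] exI[of _ u]) simp
    show "krein_inner G (op_GLt (op_L f)) f \<in> \<real>\<^sub>\<ge>\<^sub>0"
      by (simp add: krein_inner_def GB LL cinner_self_norm)
  qed
  then have "\<exists>h :: real poly. h \<noteq> 0 \<and> (\<forall>f. finitely_supported f \<longrightarrow>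
      (\<exists>g. (f, g) \<in> poly_op h (generated_operator T) \<and> krein_inner G g f \<in> \<real>\<^sub>\<ge>\<^sub>0))"
    by (intro exI[of _ "[:- x, 1:]"]) simp
  ultimately show ?thesis
    unfolding definitizable_def using tridiagonal_T by blast
qed

end

lemma operator_equivalence:
  assumes J: "bounded_matrix J" and J_sym: "\<And>i j. J i j = J j i"
  shows "definitizable G (generated_operator T) \<longleftrightarrow> bounded_matrix L"
    "spectrum (generated_operator T) - {of_real x} = spectrum (generated_operator J) - {of_real x}
      \<longleftrightarrow> bounded_matrix L"
proof -
  note nonreal = nonreal_resolvent_imp_bounded_L[OF _ _ J J_sym]
  have "bounded_matrix L" if "definitizable G (generated_operator T)"
  proof -
    obtain z0 where "z0 \<in> resolvent_set (generated_operator T)"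
      using \<open>definitizable G (generated_operator T)\<close> unfolding definitizable_def by blast
    then obtain e where e: "0 < e" "\<And>z. dist z z0 < e \<Longrightarrow> z \<in> resolvent_set (generated_operator T)"
      using open_resolvent_set[of "generated_operator T"] unfolding open_dist by blast
    show ?thesis
    proof (cases "Im z0 = 0")
      case True
      \<comment> \<open>A real resolvent point is moved off the axis by half the radius of a disc
        inside the open resolvent set.\<close>
      show ?thesis
        by (rule nonreal[of "z0 + \<i> * of_real (e / 2)"])
           (use True e in \<open>auto simp: dist_norm norm_mult simp del: of_real_divide intro!: e(2)\<close>)
    next
      case False
      then show ?thesis using e by (intro nonreal[of z0]) auto
    qed
  qed
  then show "definitizable G (generated_operator T) \<longleftrightarrow> bounded_matrix L"
    using bounded_L_imp_definitizable by blast
  have "bounded_matrix L"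
    if eq: "spectrum (generated_operator T) - {of_real x} = spectrum (generated_operator J) - {of_real x}"
  proof -
    have bl: "bounded_linear (mat_apply J)"
      by (rule bounded_linear_mat_apply[OF tridiagonal_J J])
    obtain K where K: "0 < K" "\<And>h. norm (mat_apply J h) \<le> norm h * K"
      using bounded_linear.pos_bounded[OF bl] by blast
    \<comment> \<open>Nonreal, different from the exceptional point \<open>x\<close>, and of modulus
      beyond the bound of \<open>J\<close>; equality of the spectra carries it over to
      \<open>T\<close>.\<close>
    define z where "z = \<i> * of_real (K + 1)"
    have z: "Im z \<noteq> 0" "z \<noteq> of_real x" "cmod z = K + 1"
      using K(1) by (auto simp: z_def complex_eq_iff norm_mult simp del: of_real_add)
    have "z \<in> resolvent_set (generated_operator J)"
      unfolding generated_operator_bounded[OF bl refl] using z K(1)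
      by (intro resolvent_set_bounded_graph[OF bl K(2)]) auto
    then have "z \<in> resolvent_set (generated_operator T)"
      using eq z(2) unfolding spectrum_def by blast
    then show ?thesis using z(1) by (rule nonreal)
  qed
  then show "spectrum (generated_operator T) - {of_real x} = spectrum (generated_operator J) - {of_real x}
      \<longleftrightarrow> bounded_matrix L"
    using bounded_L_imp_spectrum_eq by blast
qed

end

section \<open>Pade approximants and quasi-definite moments\<close>

lemma eventually_poly_nonzero_at_infinity:
  fixes p :: "'a::real_normed_field poly"
  assumes "p \<noteq> 0"
  shows "eventually (\<lambda>z. poly p z \<noteq> 0) at_infinity"
proof -
  obtain b where b: "\<And>z. poly p z = 0 \<Longrightarrow> norm z \<le> b"
    using finite_imp_bounded[OF poly_roots_finite[OF assms]] unfolding bounded_iff by auto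
  then show ?thesis
    by (intro eventually_at_infinityI[of "b + 1"]) (metis add_le_same_cancel1 not_one_le_zero order_trans)
qed

lemma poly_bigtheta_power:
  fixes p :: "'a::real_normed_field poly"
  assumes "p \<noteq> 0"
  shows "poly p \<in> \<Theta>[at_infinity](\<lambda>z. z ^ degree p)"
  by (rule bigthetaI_tendsto_norm[OF _ tendsto_norm[OF poly_divide_tendsto_aux]]) (use assms in simp)

text \<open>Growth at infinity sees only the degree; this turns the order condition on an
  approximant into a degree bound.\<close>

lemma poly_bigo_poly_iff:
  fixes p q :: "'a::real_normed_field poly"
  assumes "q \<noteq> 0"
  shows "poly p \<in> O[at_infinity](poly q) \<longleftrightarrow> degree p \<le> degree q"
proof
  assume le: "degree p \<le> degree q"
  show "poly p \<in> O[at_infinity](poly q)"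
  proof (cases "p = 0")
    case False
    have "poly p \<in> O[at_infinity](\<lambda>z. z ^ degree p)"
      using poly_bigtheta_power[OF False] by (rule bigthetaD1)
    also have "(\<lambda>z::'a. z ^ degree p) \<in> O[at_infinity](\<lambda>z. z ^ degree q)"
      by (rule bigoI[of _ 1], rule eventually_at_infinityI[of 1])
         (use le in \<open>auto simp: norm_power intro: power_increasing\<close>)
    also have "(\<lambda>z::'a. z ^ degree q) \<in> O[at_infinity](poly q)"
      using poly_bigtheta_power[OF assms] by (simp add: bigtheta_sym bigthetaD1)
    finally show ?thesis .
  next
    case True
    then have "poly p = (\<lambda>_. 0)" by (simp add: fun_eq_iff)
    then show ?thesis by simp
  qed
next
  assume "poly p \<in> O[at_infinity](poly q)"
  then obtain c where c: "0 < c" "eventually (\<lambda>z. norm (poly p z) \<le> c * norm (poly q z)) at_infinity"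
    by (rule landau_o.bigE)
  show "degree p \<le> degree q"
  proof (rule ccontr)
    assume "\<not> degree p \<le> degree q"
    then have deg: "degree q < degree p" by simp
    then have "p \<noteq> 0" by auto
    have "eventually (\<lambda>z. norm (poly q z / poly p z) < 1 / c) at_infinity"
      using tendstoD[OF poly_divide_tendsto_0_at_infinity[OF deg], of "1 / c"] c(1) by simp
    then have "eventually (\<lambda>z::'a. False) at_infinity"
      using c(2) eventually_poly_nonzero_at_infinity[OF \<open>p \<noteq> 0\<close>]
    proof eventually_elim
      case (elim z)
      then show False using c(1) by (simp add: norm_divide field_simps)
    qed
    then show False
      by (simp add: trivial_limit_at_infinity)
  qed
qed

text \<open>The plus sign reflects 1/(t - z) = -(1/z + t/z^2 + ...). The expansion is only
  asymptotic, so it constrains \<open>F\<close> near infinity and nowhere else.\<close>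

locale moment_expansion =
  fixes F :: "complex \<Rightarrow> complex" and s :: "nat \<Rightarrow> complex"
  assumes F_expansion:
    "(\<lambda>z. F z + (\<Sum>k\<le>N. s k / z ^ Suc k)) \<in> O[at_infinity](\<lambda>z. 1 / z ^ (N + 2))"
begin

text \<open>The linear functional with moments \<open>s\<close>, applied to p(t) t^j.\<close>

definition moment :: "complex poly \<Rightarrow> nat \<Rightarrow> complex" where
  "moment p j = (\<Sum>i\<le>degree p. coeff p i * s (i + j))"

lemma moment_eq: "degree p \<le> N \<Longrightarrow> moment p j = (\<Sum>i\<le>N. coeff p i * s (i + j))"
  unfolding moment_def by (rule sum.mono_neutral_left) (auto simp: coeff_eq_0)

lemma moment_diff: "moment (p - smult c q) j = moment p j - c * moment q j"
proof -
  let ?N = "max (degree p) (degree q)"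
  have "degree (p - smult c q) \<le> ?N"
    by (intro degree_diff_le) (auto intro: order_trans[OF degree_smult_le])
  then show ?thesis
    by (simp add: moment_eq[of _ ?N] sum_subtractf[symmetric] sum_distrib_left algebra_simps)
qed

text \<open>z^(2n+1) times the expansion truncated after \<open>s (2 * n)\<close>; later moments
  cannot influence the order 2n + 1.\<close>

definition moment_poly :: "nat \<Rightarrow> complex poly" where
  "moment_poly n = (\<Sum>k\<le>2 * n. monom (s k) (2 * n - k))"

lemma coeff_moment_poly: "coeff (moment_poly n) j = (if j \<le> 2 * n then s (2 * n - j) else 0)"
proof -
  have "(2 * n - k = j) = (k = 2 * n - j \<and> j \<le> 2 * n)" if "k \<le> 2 * n" for k
    using that by auto
  then have "coeff (moment_poly n) j = (\<Sum>k\<le>2 * n. if k = 2 * n - j then (if j \<le> 2 * n then s k else 0) else 0)"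
    unfolding moment_poly_def coeff_sum coeff_monom by (intro sum.cong refl) auto
  then show ?thesis by simp
qed

lemma coeff_mult_moment_poly:
  assumes "degree p \<le> m" "m \<le> 2 * n"
  shows "coeff (p * moment_poly n) m = moment p (2 * n - m)"
proof -
  have "2 * n - (m - i) = i + (2 * n - m)" if "i \<le> m" for i
    using assms(2) that by simp
  then show ?thesis
    unfolding coeff_mult moment_eq[OF assms(1)] coeff_moment_poly
    using assms(2) by (intro sum.cong refl) auto
qed

text \<open>The remainder of \<open>F P - Q\<close> after multiplying by \<open>- z\<^sup>2\<^sup>n\<^sup>+\<^sup>1\<close> and truncating the expansion of \<open>F\<close>.\<close>

definition pade_residue :: "nat \<Rightarrow> complex poly \<Rightarrow> complex poly \<Rightarrow> complex poly" where
  "pade_residue n Q P = P * moment_poly n + monom 1 (2 * n + 1) * Q"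

lemma coeff_pade_residue:
  "degree P \<le> m \<Longrightarrow> m \<le> 2 * n \<Longrightarrow> coeff (pade_residue n Q P) m = moment P (2 * n - m)"
  unfolding pade_residue_def coeff_add coeff_monom_mult by (simp add: coeff_mult_moment_poly)

text \<open>Replacing \<open>F\<close> by its truncated expansion changes the error by O(z^-(2n+2))
  only. What is left equals, up to sign, the residue divided by P z^(2n+1), so the order condition
  says that the residue is O(P).\<close>

lemma diagonal_pade_iff:
  "diagonal_pade F n Q P \<longleftrightarrow>
     P \<noteq> 0 \<and> degree P = n \<and> degree Q \<le> n \<and> degree (pade_residue n Q P) \<le> n"
proof (cases "P \<noteq> 0 \<and> degree P = n")
  case True
  let ?W = "pade_residue n Q P"
  let ?O = "O[at_infinity](\<lambda>z::complex. 1 / z ^ (2 * n + 1))"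
  define S where "S z = (\<Sum>k\<le>2 * n. s k / z ^ Suc k)" for z
  have "(\<lambda>z. F z + S z) \<in> O[at_infinity](\<lambda>z. 1 / z ^ (2 * n + 2))"
    unfolding S_def by (rule F_expansion)
  also have "(\<lambda>z::complex. 1 / z ^ (2 * n + 2)) \<in> ?O"
  proof (rule bigoI[of _ 1], rule eventually_at_infinityI[of 1])
    fix z :: complex assume z: "1 \<le> norm z"
    then have "norm z ^ (2 * n + 1) \<le> norm z ^ (2 * n + 2)"
      by (intro power_increasing) auto
    then show "norm (1 / z ^ (2 * n + 2)) \<le> 1 * norm (1 / z ^ (2 * n + 1))"
      unfolding norm_divide norm_power norm_one mult_1
      using z by (intro divide_left_mono mult_pos_pos zero_less_power) auto
  qed
  finally have FS: "(\<lambda>z. F z + S z) \<in> ?O" .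
  have "(\<lambda>z. F z - poly Q z / poly P z) \<in> ?O \<longleftrightarrow> (\<lambda>z. S z + poly Q z / poly P z) \<in> ?O"
  proof
    assume "(\<lambda>z. F z - poly Q z / poly P z) \<in> ?O"
    from sum_in_bigo(2)[OF FS this] show "(\<lambda>z. S z + poly Q z / poly P z) \<in> ?O"
      by simp
  next
    assume "(\<lambda>z. S z + poly Q z / poly P z) \<in> ?O"
    from sum_in_bigo(2)[OF FS this] show "(\<lambda>z. F z - poly Q z / poly P z) \<in> ?O"
      by (simp add: algebra_simps)
  qed
  also have "\<dots> \<longleftrightarrow> (\<lambda>z. poly ?W z / poly P z * (1 / z ^ (2 * n + 1))) \<in> ?O"
  proof (rule landau_o.big.in_cong)
    have "eventually (\<lambda>z. poly P z \<noteq> 0) at_infinity" "eventually (\<lambda>z::complex. z \<noteq> 0) at_infinity"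
      using True by (intro eventually_poly_nonzero_at_infinity eventually_at_infinityI[of 1]; auto)+
    then show "eventually (\<lambda>z. S z + poly Q z / poly P z = poly ?W z / poly P z * (1 / z ^ (2 * n + 1))) at_infinity"
    proof eventually_elim
      case z: (elim z)
      have "poly (moment_poly n) z = z ^ (2 * n + 1) * S z"
        unfolding moment_poly_def S_def poly_sum poly_monom sum_distrib_left
        using z(2) by (intro sum.cong refl) (simp add: power_diff field_simps power_add[symmetric])
      then have "poly ?W z = z ^ (2 * n + 1) * (poly P z * S z + poly Q z)"
        by (simp add: pade_residue_def poly_monom algebra_simps)
      then show "S z + poly Q z / poly P z = poly ?W z / poly P z * (1 / z ^ (2 * n + 1))"
        using z by (simp add: field_simps)
    qed
  qed
  also have "\<dots> \<longleftrightarrow> poly ?W \<in> O[at_infinity](poly P)"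
  proof -
    have "eventually (\<lambda>z. poly P z \<noteq> 0 \<and> z \<noteq> 0) at_infinity"
      using True by (intro eventually_conj eventually_poly_nonzero_at_infinity eventually_at_infinityI[of 1]) auto
    then have ev: "eventually (\<lambda>z. (norm (poly ?W z / poly P z * (1 / z ^ (2 * n + 1))) \<le> c * norm (1 / z ^ (2 * n + 1)))
        = (norm (poly ?W z) \<le> c * norm (poly P z))) at_infinity" for c
      by eventually_elim (simp add: norm_mult norm_divide norm_power field_simps)
    show ?thesis
      unfolding bigo_def using eventually_subst[OF ev] by simp
  qed
  also have "\<dots> \<longleftrightarrow> degree ?W \<le> n"
    using True poly_bigo_poly_iff[of P ?W] by simp
  finally show ?thesis
    using True unfolding diagonal_pade_def by simp
qed (auto simp: diagonal_pade_def)

end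

text \<open>The functional need not be positive: a nonzero \<open>moment (K n) n\<close> replaces
  the positive norm of an orthogonal polynomial and makes every diagonal index normal.\<close>

locale quasi_definite_moments = moment_expansion +
  fixes K :: "nat \<Rightarrow> complex poly"
  assumes degree_K: "degree (K n) = n"
    and orthogonal: "j < n \<Longrightarrow> moment (K n) j = 0"
    and nondegenerate: "moment (K n) n \<noteq> 0"
begin

lemma K_nonzero: "K n \<noteq> 0"
  using nondegenerate[of n] by (auto simp: moment_def)

text \<open>Pair \<open>p\<close> with the \<open>K\<close> of equal degree. The Hankel pairing is
  symmetric, so it can be summed through the moments of \<open>p\<close> or through those of
  \<open>K\<close>, where only the leading coefficient of \<open>p\<close> survives, against a
  nonzero moment.\<close>

lemma moments_not_all_zero:
  assumes "p \<noteq> 0"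
  shows "\<exists>j\<le>degree p. moment p j \<noteq> 0"
proof (rule ccontr)
  let ?d = "degree p"
  assume *: "\<not> (\<exists>j\<le>?d. moment p j \<noteq> 0)"
  have "(\<Sum>i\<le>?d. coeff p i * moment (K ?d) i) = (\<Sum>j\<le>?d. coeff (K ?d) j * moment p j)"
    unfolding moment_def degree_K sum_distrib_left
    by (subst sum.swap) (simp add: algebra_simps)
  also have "\<dots> = 0" using * by (intro sum.neutral) auto
  finally have "(\<Sum>i\<in>{?d}. coeff p i * moment (K ?d) i) = 0"
    by (subst (asm) sum.mono_neutral_right[of _ "{?d}"]) (auto intro!: orthogonal)
  then show False
    using nondegenerate assms by simp
qed

text \<open>The degree bound kills the coefficients n+1 to 2n of the residue, which are the moments
  j < n of \<open>P\<close>. Subtracting the multiple of \<open>K n\<close> with equal leading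
  coefficient leaves degree below n and the same vanishing moments, hence zero.\<close>

lemma diagonal_pade_denominator:
  assumes "diagonal_pade F n Q P"
  shows "\<exists>c. P = smult c (K n)"
proof -
  have P: "P \<noteq> 0" "degree P = n" and W: "degree (pade_residue n Q P) \<le> n"
    using assms unfolding diagonal_pade_iff by auto
  have orth: "moment P j = 0" if "j < n" for j
    using coeff_pade_residue[of P "2 * n - j" n Q] coeff_eq_0[of "pade_residue n Q P" "2 * n - j"] W P that
    by simp
  define c where "c = coeff P n / coeff (K n) n"
  define D where "D = P - smult c (K n)"
  have "D = 0"
  proof (rule ccontr)
    assume "D \<noteq> 0"
    have "coeff D n = 0"
      using leading_coeff_neq_0[of "K n"] K_nonzero[of n] by (simp add: D_def c_def degree_K)
    moreover have "degree D \<le> n"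
      unfolding D_def using P(2) degree_K[of n]
      by (intro degree_diff_le) (auto intro: order_trans[OF degree_smult_le])
    ultimately have "degree D < n"
      using \<open>D \<noteq> 0\<close> by (metis le_neq_implies_less leading_coeff_0_iff)
    then show False
      using moments_not_all_zero[OF \<open>D \<noteq> 0\<close>] by (auto simp: D_def moment_diff orth orthogonal)
  qed
  then show ?thesis unfolding D_def by auto
qed

lemma diagonal_pade_exists: "\<exists>Q. diagonal_pade F n Q (K n)"
proof
  define R where "R = K n * moment_poly n"
  \<comment> \<open>\<open>Q\<close> removes the coefficients of the residue from 2n + 1 on, while
    orthogonality removes those from n + 1 to 2n. As \<open>R\<close> has degree at most 3n, the
    shift has an admissible degree.\<close>
  define Q where "Q = - poly_shift (2 * n + 1) R"
  have "coeff R i = 0" if "3 * n < i" for i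
  proof (rule coeff_eq_0)
    have "degree (moment_poly n) \<le> 2 * n"
      by (rule degree_le) (simp add: coeff_moment_poly)
    then have "degree R \<le> n + 2 * n"
      unfolding R_def using degree_mult_le[of "K n" "moment_poly n"] degree_K[of n] by simp
    then show "degree R < i" using that by simp
  qed
  then have "degree Q \<le> n"
    by (intro degree_le) (auto simp: Q_def coeff_poly_shift)
  moreover have "degree (pade_residue n Q (K n)) \<le> n"
  proof (intro degree_le allI impI)
    fix i assume "n < i"
    show "coeff (pade_residue n Q (K n)) i = 0"
    proof (cases "i \<le> 2 * n")
      case True
      then show ?thesis
        using \<open>n < i\<close> by (subst coeff_pade_residue) (auto simp: degree_K intro!: orthogonal)
    next
      case False
      then show ?thesis
        unfolding pade_residue_def coeff_add coeff_monom_mult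
        by (simp add: Q_def coeff_poly_shift R_def)
    qed
  qed
  ultimately show "diagonal_pade F n Q (K n)"
    unfolding diagonal_pade_iff by (simp add: K_nonzero degree_K)
qed

text \<open>Cancelling a common factor lowers the degree of the residue as well, so the reduced
  denominator would have all moments up to its own degree zero, which
  \<open>moments_not_all_zero\<close> excludes.\<close>

lemma diagonal_pade_coprime:
  assumes pade: "diagonal_pade F n Q P" and z: "poly P z = 0"
  shows "poly Q z \<noteq> 0"
proof
  assume "poly Q z = 0"
  with z obtain P' Q' where P': "P = [:- z, 1:] * P'" and Q': "Q = [:- z, 1:] * Q'"
    unfolding poly_eq_0_iff_dvd dvd_def by blast
  have P: "P \<noteq> 0" "degree P = n" and W: "degree (pade_residue n Q P) \<le> n"
    using pade unfolding diagonal_pade_iff by auto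
  have "P' \<noteq> 0" using P(1) P' by auto
  then have "degree P = degree [:- z, 1:] + degree P'"
    unfolding P' by (intro degree_mult_eq) auto
  then have n: "n = Suc (degree P')"
    using P(2) by simp
  let ?W = "pade_residue n Q' P'"
  have "pade_residue n Q P = [:- z, 1:] * ?W"
    unfolding pade_residue_def P' Q' by (simp add: algebra_simps)
  then have W': "degree ?W < n"
    using W n degree_mult_eq[of "[:- z, 1:]" ?W] by (cases "?W = 0") (auto simp del: mult_pCons_left)
  have "moment P' j = 0" if "j \<le> degree P'" for j
    using coeff_pade_residue[of P' "2 * n - j" n Q'] coeff_eq_0[of ?W "2 * n - j"] W' n that
    by simp
  then show False
    using moments_not_all_zero[OF \<open>P' \<noteq> 0\<close>] by blast
qed

text \<open>Uniqueness of the denominator gives one inclusion; existence together with the absence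
  of cancellation gives the other.\<close>

theorem pade_poles_eq: "pade_poles F = {z. \<exists>n. poly (K n) z = 0}"
proof (intro set_eqI iffI)
  fix z assume "z \<in> pade_poles F"
  then obtain n Q P where pade: "diagonal_pade F n Q P" and pole: "is_pole (\<lambda>w. poly Q w / poly P w) z"
    unfolding pade_poles_def by blast
  obtain c where c: "P = smult c (K n)"
    using diagonal_pade_denominator[OF pade] by blast
  have "P \<noteq> 0" using pade unfolding diagonal_pade_def by blast
  have "poly P z = 0"
  proof (rule ccontr)
    assume "poly P z \<noteq> 0"
    then have "\<not> is_pole (\<lambda>w. poly Q w / poly P w) z"
      by (intro not_is_pole_holomorphic[of "- {w. poly P w = 0}"] finite_imp_closed[THEN open_Compl]
          poly_roots_finite \<open>P \<noteq> 0\<close> holomorphic_intros) auto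
    with pole show False by contradiction
  qed
  then have "poly (K n) z = 0"
    using c \<open>P \<noteq> 0\<close> by auto
  then show "z \<in> {z. \<exists>n. poly (K n) z = 0}" by blast
next
  fix z assume "z \<in> {z. \<exists>n. poly (K n) z = 0}"
  then obtain n where n: "poly (K n) z = 0" by blast
  obtain Q where pade: "diagonal_pade F n Q (K n)"
    using diagonal_pade_exists by blast
  have "filterlim (poly (K n)) (at 0) (at z)"
  proof -
    have "(poly (K n) \<longlongrightarrow> 0) (at z)"
      using isContD[of z "poly (K n)"] n by (simp add: poly_isCont)
    moreover have "eventually (\<lambda>w. poly (K n) w \<noteq> 0) (at z)"
      using islimpt_finite[OF poly_roots_finite[OF K_nonzero[of n]], of z]
      by (simp add: islimpt_iff_eventually)
    ultimately show ?thesis by (simp add: filterlim_at)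
  qed
  then have "is_pole (\<lambda>w. poly Q w / poly (K n) w) z"
    using diagonal_pade_coprime[OF pade n] by (intro is_pole_divide) (auto simp: poly_isCont)
  then show "z \<in> pade_poles F"
    unfolding pade_poles_def using pade by blast
qed

end

section \<open>Orthogonal polynomials on the interval\<close>

locale jacobi_measure =
  fixes J :: smatrix and \<mu> :: "real measure" and P :: "nat \<Rightarrow> real poly"
  assumes jacobi: "jacobi_matrix J"
    and prob: "prob_space \<mu>" and sets_\<mu>: "sets \<mu> = sets borel"
    and support: "measure_support \<mu> \<subseteq> {-1..1}"
    and P_orthonormal: "orthonormal_polys \<mu> P" and P_0: "P 0 = 1"
    and P_rec: "(\<Sum>j. J i j * poly (P j) t) = t * poly (P i) t"
begin

sublocale prob_space \<mu> by (rule prob)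

text \<open>Outside the support every point has an open null neighbourhood; the Lindelof property
  makes countably many of them suffice.\<close>

lemma AE_interval: "AE t in \<mu>. t \<in> {-1..1}"
proof -
  let ?\<U> = "{U. open U \<and> emeasure \<mu> U = 0}"
  obtain \<V> where \<V>: "\<V> \<subseteq> ?\<U>" "countable \<V>" "\<Union>\<V> = \<Union>?\<U>"
    by (rule Lindelof[of ?\<U>]) auto
  have "(\<Union>U\<in>\<V>. U) \<in> null_sets \<mu>"
    using \<V>(1) by (intro null_sets_UN' \<V>(2)) (auto intro!: null_setsI simp: sets_\<mu>)
  moreover have "{t \<in> space \<mu>. t \<notin> {-1..1}} \<subseteq> (\<Union>U\<in>\<V>. U)"
  proof
    fix t assume "t \<in> {t \<in> space \<mu>. t \<notin> {-1..1}}"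
    then have "t \<notin> measure_support \<mu>" using support by auto
    then have "t \<in> \<Union>?\<U>"
      unfolding measure_support_def by (auto simp: zero_less_iff_neq_zero)
    then show "t \<in> (\<Union>U\<in>\<V>. U)" using \<V>(3) by simp
  qed
  ultimately show ?thesis by (rule AE_I')
qed

lemma set_integrable_continuous:
  fixes f :: "real \<Rightarrow> 'b::{banach, second_countable_topology}"
  assumes "continuous_on {-1..1} f"
  shows "set_integrable \<mu> {-1..1} f"
proof -
  have "bounded (f ` {-1..1})"
    by (intro compact_imp_bounded compact_continuous_image assms) simp
  then obtain B where B: "\<And>t. t \<in> {-1..1} \<Longrightarrow> norm (f t) \<le> B"
    unfolding bounded_iff by blast
  have "norm (indicat_real {-1..1} t *\<^sub>R f t) \<le> \<bar>B\<bar>" for t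
    using B[of t] by (auto simp: indicator_def)
  moreover have "(\<lambda>t. indicat_real {-1..1} t *\<^sub>R f t) \<in> borel_measurable \<mu>"
    using borel_measurable_continuous_on_indicator[OF _ assms]
    by (simp add: measurable_cong_sets[OF sets_\<mu> refl])
  ultimately show ?thesis
    unfolding set_integrable_def by (intro integrable_const_bound[of _ "\<bar>B\<bar>"]) auto
qed

text \<open>Confined to [-1,1], every continuous integrand is bounded and hence integrable;
  \<open>E_eq\<close> recovers the integral over the whole line.\<close>

definition E :: "real poly \<Rightarrow> real" where
  "E p = (LINT t:{-1..1}|\<mu>. poly p t)"

lemma set_integrable_poly: "set_integrable \<mu> {-1..1} (poly (p :: real poly))"
  by (intro set_integrable_continuous continuous_intros)

lemma E_eq: "(\<integral>t. poly p t \<partial>\<mu>) = E p"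
  unfolding E_def set_lebesgue_integral_def
proof (rule integral_cong_AE)
  have "poly p \<in> borel_measurable \<mu>"
    unfolding measurable_cong_sets[OF sets_\<mu> refl]
    by (intro borel_measurable_continuous_onI continuous_intros)
  then show "poly p \<in> borel_measurable \<mu>" .
  show "(\<lambda>t. indicat_real {-1..1} t *\<^sub>R poly p t) \<in> borel_measurable \<mu>"
    using set_integrable_poly[of p] unfolding set_integrable_def by (rule borel_measurable_integrable)
  show "AE t in \<mu>. poly p t = indicat_real {-1..1} t *\<^sub>R poly p t"
    using AE_interval by eventually_elim (simp add: indicator_def)
qed

lemma E_add: "E (p + q) = E p + E q"
  unfolding E_def poly_add by (intro set_integral_add set_integrable_poly)

lemma E_smult: "E (smult c p) = c * E p"
  unfolding E_def poly_smult by simp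

lemma E_diff: "E (p - q) = E p - E q"
  unfolding E_def poly_diff by (intro set_integral_diff set_integrable_poly)

lemma E_sum: "E (\<Sum>i\<in>A. f i) = (\<Sum>i\<in>A. E (f i))"
  using E_smult[of 0 0] by (induction A rule: infinite_finite_induct) (auto simp: E_add)

lemma E_mono:
  assumes "\<And>t. \<bar>t\<bar> \<le> 1 \<Longrightarrow> \<bar>poly p t\<bar> \<le> poly q t"
  shows "\<bar>E p\<bar> \<le> E q"
proof -
  have "E p \<le> E q" "E (- p) \<le> E q"
    unfolding E_def
    by (intro set_integral_mono set_integrable_poly; use assms in \<open>force simp: abs_le_iff\<close>)+
  then show ?thesis using E_smult[of "- 1" p] by simp
qed

section \<open>Recurrence coefficients and orthogonality\<close>

lemma E_P_P: "E (P m * P n) = (if m = n then 1 else 0)"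
proof -
  have "poly (P m * P n) = (\<lambda>t. poly (P m) t * poly (P n) t)" by auto
  then show ?thesis
    using P_orthonormal unfolding orthonormal_polys_def E_eq[symmetric] by simp
qed

lemma degree_P: "degree (P n) = n"
  using P_orthonormal unfolding orthonormal_polys_def by blast

lemma tridiagonal_J: "tridiagonal J" and J_sym: "J i j = J j i" and J_pos: "0 < J k (Suc k)"
  using jacobi unfolding jacobi_matrix_def by auto

abbreviation X :: "real poly" where "X \<equiv> [:0, 1:]"

lemma P_rec_poly:
  "X * P i = smult (J i i) (P i) + smult (J i (Suc i)) (P (Suc i))
    + (if i = 0 then 0 else smult (J i (i - 1)) (P (i - 1)))"
proof -
  have "poly (X * P i) t = poly (smult (J i i) (P i) + smult (J i (Suc i)) (P (Suc i))
    + (if i = 0 then 0 else smult (J i (i - 1)) (P (i - 1)))) t" for t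
    using P_rec[of i t] suminf_tridiagonal[OF tridiagonal_J, of i "\<lambda>j. poly (P j) t"] by auto
  then show ?thesis by (intro poly_eq_poly_eq_iff[THEN iffD1] ext)
qed

lemma E_X_P_P: "E (X * P i * P j) = (if j = i then J i i else if j = Suc i then J i j else if i = Suc j then J i j else 0)"
  unfolding P_rec_poly
  by (cases i) (auto simp: distrib_right E_add E_smult E_P_P)

text \<open>For |t| \<le> 1 the integrand t P_i P_j is dominated by (P_i^2 + P_j^2)/2, whose
  integral is 1. This bound is the source of the numerical constants in the estimates of
  zeros.\<close>

lemma J_le_1: "\<bar>J i j\<bar> \<le> 1"
proof -
  have E_half: "E (smult (1 / 2) (P i * P i + P j * P j)) = 1"
    by (simp add: E_smult E_add E_P_P)
  have "\<bar>E (X * P i * P j)\<bar> \<le> E (smult (1 / 2) (P i * P i + P j * P j))"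
  proof (rule E_mono)
    fix t :: real assume "\<bar>t\<bar> \<le> 1"
    let ?u = "poly (P i) t" and ?v = "poly (P j) t"
    have "\<bar>poly (X * P i * P j) t\<bar> = \<bar>t\<bar> * (\<bar>?u\<bar> * \<bar>?v\<bar>)"
      by (simp add: abs_mult)
    also have "\<dots> \<le> 1 * (\<bar>?u\<bar> * \<bar>?v\<bar>)"
      by (rule mult_right_mono) (use \<open>\<bar>t\<bar> \<le> 1\<close> in auto)
    also have "\<dots> \<le> (?u * ?u + ?v * ?v) / 2"
      using zero_le_power2[of "\<bar>?u\<bar> - \<bar>?v\<bar>"] by (simp add: power2_eq_square algebra_simps)
    finally show "\<bar>poly (X * P i * P j) t\<bar> \<le> poly (smult (1 / 2) (P i * P i + P j * P j)) t"
      by simp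
  qed
  then have "\<bar>E (X * P i * P j)\<bar> \<le> 1" unfolding E_half .
  moreover have "J i j = 0" if "j \<noteq> i" "j \<noteq> Suc i" "i \<noteq> Suc j"
    using tridiagonal_zero[OF tridiagonal_J, of i j] that by linarith
  ultimately show ?thesis
    unfolding E_X_P_P by (auto split: if_splits)
qed

lemma bounded_matrix_J: "bounded_matrix J"
  unfolding bounded_matrix_def using J_le_1 by blast

text \<open>Strip the top coefficient with a multiple of \<open>P k\<close>. Counting coefficients
  instead of using \<open>degree\<close> makes the zero polynomial the base case.\<close>

lemma P_orthogonal:
  assumes "\<And>i. k \<le> i \<Longrightarrow> coeff p i = 0" "k \<le> n"
  shows "E (P n * p) = 0"
  using assms
proof (induction k arbitrary: p)
  case 0
  then have "p = 0" by (intro poly_eqI) simp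
  then show ?case using E_smult[of 0 0] by simp
next
  case (Suc k)
  define c where "c = coeff p k / coeff (P k) k"
  have Pk: "coeff (P k) k \<noteq> 0"
    using degree_P[of k] E_P_P[of k k] E_smult[of 0 0] by (metis leading_coeff_0_iff mult_zero_left smult_0_left zero_neq_one mult_eq_0_iff)
  have "E (P n * (p - smult c (P k))) = 0"
  proof (rule Suc.IH)
    fix i assume "k \<le> i"
    show "coeff (p - smult c (P k)) i = 0"
    proof (cases "i = k")
      case True
      then show ?thesis using Pk by (simp add: c_def)
    next
      case False
      then show ?thesis
        using \<open>k \<le> i\<close> Suc.prems(1)[of i] by (simp add: coeff_eq_0 degree_P)
    qed
  qed (use Suc.prems in simp)
  then show ?case
    using Suc.prems(2) by (simp add: right_diff_distrib E_diff E_smult E_P_P)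
qed

lemma E_P_monom: "j < n \<Longrightarrow> E (P n * monom 1 j) = 0"
  by (rule P_orthogonal[of "Suc j"]) auto

lemma E_P_monom_self: "E (P n * monom 1 n) \<noteq> 0"
proof
  assume *: "E (P n * monom 1 n) = 0"
  have "E (P n * (P n - smult (coeff (P n) n) (monom 1 n))) = 0"
    by (rule P_orthogonal[of n]) (auto simp: coeff_eq_0 degree_P)
  then show False
    using * by (simp add: right_diff_distrib E_diff E_smult E_P_P)
qed

text \<open>Iterating 1/(t - z) = -1/z + t/(z (t - z)) gives the geometric expansion with the exact
  remainder \<open>f N z\<close>, so no infinite series has to be integrated.\<close>

lemma shifted_markov_expansion:
  "(\<lambda>z. shifted_markov_function \<mu> x z + (\<Sum>k\<le>N. of_real (E (monom 1 k * [:- x, 1:])) / z ^ Suc k))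
     \<in> O[at_infinity](\<lambda>z. 1 / z ^ (N + 2))"
proof -
  define f where "f N z t = of_real (t - x) * of_real t ^ N / (z ^ N * (of_real t - z))"
    for N and z :: complex and t :: real
  have neq: "of_real t \<noteq> z" if "t \<in> {-1..1}" "2 \<le> cmod z" for t z
    using that by auto
  have int: "set_integrable \<mu> {-1..1} (f N z)" if "2 \<le> cmod z" for N z
    unfolding f_def using that neq
    by (intro set_integrable_continuous continuous_intros) auto
  have eq: "shifted_markov_function \<mu> x z + (\<Sum>k<N. of_real (E (monom 1 k * [:- x, 1:])) / z ^ Suc k)
      = (LINT t:{-1..1}|\<mu>. f N z t)" if z: "2 \<le> cmod z" for N z
  proof (induction N)
    case 0
    show ?case by (simp add: shifted_markov_function_def f_def mult.commute)
  next
    case (Suc N)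
    have z0: "z \<noteq> 0" using z by auto
    have moment: "of_real (E (monom 1 N * [:- x, 1:])) / z ^ Suc N
        = (LINT t:{-1..1}|\<mu>. of_real (poly (monom 1 N * [:- x, 1:]) t) / z ^ Suc N)"
      unfolding E_def by (simp only: set_integral_complex_of_real set_integral_divide_zero)
    have int': "set_integrable \<mu> {-1..1} (\<lambda>t. of_real (poly (monom 1 N * [:- x, 1:]) t) / z ^ Suc N)"
      using z0 by (intro set_integrable_continuous continuous_intros) auto
    have "shifted_markov_function \<mu> x z + (\<Sum>k<Suc N. of_real (E (monom 1 k * [:- x, 1:])) / z ^ Suc k)
        = (LINT t:{-1..1}|\<mu>. f N z t)
          + (LINT t:{-1..1}|\<mu>. of_real (poly (monom 1 N * [:- x, 1:]) t) / z ^ Suc N)"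
      by (simp only: sum.lessThan_Suc add.assoc[symmetric] Suc.IH moment)
    also have "\<dots> = (LINT t:{-1..1}|\<mu>. f N z t + of_real (poly (monom 1 N * [:- x, 1:]) t) / z ^ Suc N)"
      by (rule set_integral_add(2)[OF int[OF z] int', symmetric])
    also have "\<dots> = (LINT t:{-1..1}|\<mu>. f (Suc N) z t)"
    proof (rule set_lebesgue_integral_cong)
      show "{-1..1} \<in> sets \<mu>" by (simp add: sets_\<mu>)
      show "\<forall>t. t \<in> {-1..1} \<longrightarrow> f N z t + of_real (poly (monom 1 N * [:- x, 1:]) t) / z ^ Suc N = f (Suc N) z t"
        using neq[OF _ z] z0 unfolding f_def by (auto simp: poly_monom field_simps)
    qed
    finally show ?case .
  qed
  \<comment> \<open>For |z| \<ge> 2 and |t| \<le> 1 one has |t - z| \<ge> |z|/2 and |t - x| \<le> 1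
    + |x|, and the total mass is 1; this yields the constant.\<close>
  show ?thesis
  proof (rule bigoI[of _ "2 * (1 + \<bar>x\<bar>)"], rule eventually_at_infinityI[of 2])
    fix z :: complex assume z: "2 \<le> cmod z"
    let ?C = "2 * (1 + \<bar>x\<bar>) * norm (1 / z ^ (N + 2))"
    have bound: "norm (f (Suc N) z t) \<le> ?C" if t: "t \<in> {-1..1}" for t
    proof -
      have "\<bar>t\<bar> \<le> 1" using t by auto
      then have "cmod z / 2 \<le> cmod (of_real t - z)"
        using z norm_triangle_ineq2[of z "of_real t"] by (simp add: norm_minus_commute)
      moreover have "\<bar>t - x\<bar> * \<bar>t\<bar> ^ Suc N \<le> (1 + \<bar>x\<bar>) * 1"
        using t by (intro mult_mono power_le_one) auto
      ultimately have "\<bar>t - x\<bar> * \<bar>t\<bar> ^ Suc N / (cmod z ^ Suc N * cmod (of_real t - z))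
          \<le> (1 + \<bar>x\<bar>) * 1 / (cmod z ^ Suc N * (cmod z / 2))"
        using z by (intro frac_le mult_left_mono mult_pos_pos zero_less_power) auto
      moreover have "norm (f (Suc N) z t) = \<bar>t - x\<bar> * \<bar>t\<bar> ^ Suc N / (cmod z ^ Suc N * cmod (of_real t - z))"
        unfolding f_def norm_divide norm_mult norm_power norm_of_real ..
      ultimately show ?thesis
        by (simp add: norm_divide norm_power norm_mult mult_ac)
    qed
    have "norm (LINT t:{-1..1}|\<mu>. f (Suc N) z t) \<le> ?C"
      unfolding set_lebesgue_integral_def
    proof (rule order_trans[OF integral_norm_bound integral_le_const])
      show "integrable \<mu> (\<lambda>t. norm (indicat_real {-1..1} t *\<^sub>R f (Suc N) z t))"
        using int[OF z] unfolding set_integrable_def by (rule integrable_norm)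
      have "0 \<le> ?C" by simp
      then show "AE t in \<mu>. norm (indicat_real {-1..1} t *\<^sub>R f (Suc N) z t) \<le> ?C"
        using bound by (intro AE_I2) (simp add: indicator_def)
    qed
    then show "norm (shifted_markov_function \<mu> x z + (\<Sum>k\<le>N. of_real (E (monom 1 k * [:- x, 1:])) / z ^ Suc k)) \<le> ?C"
      using eq[OF z, of "Suc N"] by (simp add: lessThan_Suc_atMost)
  qed
qed

end

section \<open>Poles of the Pade approximants\<close>

lemma of_real_poly_add:
  "map_poly complex_of_real (p + q) = map_poly of_real p + map_poly of_real q"
  by (intro poly_eqI) (simp add: coeff_map_poly)

lemma of_real_poly_smult:
  "map_poly complex_of_real (smult c p) = smult (of_real c) (map_poly of_real p)"
  by (intro poly_eqI) (simp add: coeff_map_poly)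

lemma of_real_poly_mult:
  "map_poly complex_of_real (p * q) = map_poly of_real p * map_poly of_real q"
  by (intro poly_eqI) (simp add: coeff_map_poly coeff_mult)

lemma of_real_poly_eval: "poly (map_poly complex_of_real p) (of_real t) = of_real (poly p t)"
  by (induction p) (simp_all add: map_poly_pCons)

locale darboux_measure = darboux J L G x + jacobi_measure J \<mu> P
  for J L G :: smatrix and x :: real and \<mu> :: "real measure" and P :: "nat \<Rightarrow> real poly" +
  assumes x_bound: "\<bar>x\<bar> < 1"
begin

lemma sig_cases: "G k k = 1 \<or> G k k = -1"
  using sig unfolding signature_matrix_def by blast

lemma LGL_entry: "(L \<odot> G \<odot> L') i j = (\<Sum>k. L i k * G k k * L j k)"
  unfolding mat_mult_def[of "L \<odot> G" L'] signature_mat_mult[OF sig] by (simp add: transp_mat_def)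

lemma L_zero: "i \<noteq> j \<Longrightarrow> i \<noteq> Suc j \<Longrightarrow> L i j = 0"
  using bidiag unfolding lower_bidiagonal_def by blast

lemma J_offdiag: "J k (Suc k) = L k k * G k k * L (Suc k) k"
proof -
  have "L k i = 0 \<or> L (Suc k) i = 0" if "i \<noteq> k" for i
    using that L_zero[of k i] L_zero[of "Suc k" i] by (cases "k = Suc i") auto
  then have "(L \<odot> G \<odot> L') k (Suc k) = (\<Sum>i\<in>{k}. L k i * G i i * L (Suc k) i)"
    unfolding LGL_entry by (intro suminf_finite) auto
  moreover have "J k (Suc k) = (L \<odot> G \<odot> L') k (Suc k)"
    by (subst J_eq) (simp add: id_mat_def)
  ultimately show ?thesis by simp
qed

lemma J_diag_Suc:
  "J (Suc k) (Suc k) - x = (L (Suc k) k)\<^sup>2 * G k k + (L (Suc k) (Suc k))\<^sup>2 * G (Suc k) (Suc k)"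
proof -
  have "(L \<odot> G \<odot> L') (Suc k) (Suc k) = (\<Sum>i\<in>{k, Suc k}. L (Suc k) i * G i i * L (Suc k) i)"
    unfolding LGL_entry by (intro suminf_finite) (auto simp: L_zero)
  moreover have "J (Suc k) (Suc k) - x = (L \<odot> G \<odot> L') (Suc k) (Suc k)"
    by (subst J_eq) (simp add: id_mat_def)
  ultimately show ?thesis by (simp add: power2_eq_square mult_ac)
qed

lemma subdiag_nonzero: "L (Suc k) k \<noteq> 0"
  using J_offdiag[of k] J_pos[of k] by auto

text \<open>The pivots of Gaussian elimination on J - x, that is, the numbers d_n of the
  overview.\<close>

definition pivot :: "nat \<Rightarrow> real" where
  "pivot k = G k k * (L k k)\<^sup>2"

text \<open>A pivot is a squared diagonal entry up to sign. The subdiagonal follows from the bounded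
  diagonal of \<open>J\<close>, because \<open>J (Suc k) (Suc k) - x\<close> is a signed sum of the
  squares of the two entries in that row of \<open>L\<close>.\<close>

lemma bounded_matrix_L_iff: "bounded_matrix L \<longleftrightarrow> (\<exists>C. \<forall>k. \<bar>pivot k\<bar> \<le> C)"
proof
  assume "bounded_matrix L"
  then obtain C where C: "\<And>i j. \<bar>L i j\<bar> \<le> C"
    unfolding bounded_matrix_def by blast
  have "\<bar>pivot k\<bar> \<le> C\<^sup>2" for k
    using sig_cases[of k] power_mono[OF C[of k k], of 2] by (auto simp: pivot_def abs_mult)
  then show "\<exists>C. \<forall>k. \<bar>pivot k\<bar> \<le> C" by blast
next
  assume "\<exists>C. \<forall>k. \<bar>pivot k\<bar> \<le> C"
  then obtain C where C: "\<And>k. \<bar>pivot k\<bar> \<le> C" by blast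
  have diag: "(L k k)\<^sup>2 \<le> C" for k
    using C[of k] sig_cases[of k] by (auto simp: pivot_def abs_mult)
  have sub: "(L (Suc k) k)\<^sup>2 \<le> C + 1 + \<bar>x\<bar>" for k
  proof -
    define u v where "u = (L (Suc k) k)\<^sup>2" and "v = (L (Suc k) (Suc k))\<^sup>2"
    have "0 \<le> u" "0 \<le> v" "v \<le> C" using diag by (auto simp: u_def v_def)
    then have "u = \<bar>u * G k k\<bar>" "\<bar>v * G (Suc k) (Suc k)\<bar> \<le> C"
      using sig_cases[of k] sig_cases[of "Suc k"] by (auto simp: abs_mult)
    moreover have "J (Suc k) (Suc k) - x = u * G k k + v * G (Suc k) (Suc k)"
      by (simp add: J_diag_Suc u_def v_def)
    moreover have "\<bar>J (Suc k) (Suc k)\<bar> \<le> 1" by (rule J_le_1)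
    ultimately have "u \<le> C + 1 + \<bar>x\<bar>" by linarith
    then show ?thesis by (simp add: u_def)
  qed
  have "0 \<le> C" using C[of 0] by linarith
  have "(L i j)\<^sup>2 \<le> C + 1 + \<bar>x\<bar>" for i j
    using diag[of i] sub[of j] L_zero[of i j] \<open>0 \<le> C\<close> by (cases "i = j"; cases "i = Suc j") auto
  then have "\<bar>L i j\<bar> \<le> sqrt (C + 1 + \<bar>x\<bar>)" for i j
    by (intro real_le_rsqrt) simp
  then show "bounded_matrix L"
    unfolding bounded_matrix_def by blast
qed

text \<open>\<open>kernel_num n\<close> is \<open>t - x\<close> times a multiple of the \<open>n\<close>-th Christoffel--Darboux kernel polynomial at \<open>x\<close>.\<close>

definition kernel_num :: "nat \<Rightarrow> real poly" where
  "kernel_num n = smult (L n n) (P n) + smult (L (Suc n) n) (P (Suc n))"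

definition kernel :: "nat \<Rightarrow> real poly" where
  "kernel n = kernel_num n div [:- x, 1:]"

text \<open>The vector p(x) of values is a formal null vector of J - x = L (G L^T). It need not be
  square summable, but forward substitution makes \<open>L\<close> injective on all sequences, so G
  L^T p(x) = 0; entry \<open>n\<close> of this is the claim up to sign.\<close>

lemma poly_kernel_num: "poly (kernel_num n) x = 0"
proof -
  define y where "y j = complex_of_real (poly (P j) x)" for j
  define w where "w = seq_apply G (seq_apply L' y)"
  have "seq_apply J y i = of_real x * y i" for i
  proof -
    have "poly (X * P i) x = x * poly (P i) x" by simp
    then show ?thesis
      unfolding P_rec_poly seq_apply_three[OF tridiagonal_J] y_def
      by (auto simp flip: of_real_mult of_real_add)
  qed
  then have Lw: "seq_apply L w i = 0" for i
    using seq_apply_J[of y i] by (simp add: w_def)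
  have w0: "w i = 0" for i
  proof (induction i)
    case 0
    then show ?case
      using Lw[of 0] L_pos[of 0] by (simp add: seq_apply_three[OF tri_L] L_zero)
  next
    case (Suc i)
    then show ?case
      using Lw[of "Suc i"] L_pos[of "Suc i"] by (simp add: seq_apply_three[OF tri_L] L_zero)
  qed
  have "w n = of_real (G n n * poly (kernel_num n) x)"
  proof -
    have "L' n i = 0" if "i \<noteq> n" "i \<noteq> Suc n" for i
      using that by (simp add: transp_mat_def L_zero)
    moreover have "G n i = 0" if "i \<noteq> n" for i
      using sig that unfolding signature_matrix_def by metis
    ultimately show ?thesis
      by (auto simp: w_def seq_apply_three[OF tri_G] seq_apply_three[OF tri_L'] kernel_num_def y_def
          transp_mat_def L_zero)
  qed
  then show ?thesis
    using w0[of n] sig_cases[of n] by auto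
qed

lemma kernel_num_eq: "kernel_num n = [:- x, 1:] * kernel n"
  using poly_kernel_num[of n] unfolding kernel_def by (simp only: poly_eq_0_iff_dvd dvd_mult_div_cancel)

lemma degree_kernel: "degree (kernel n) = n"
proof -
  have "degree (kernel_num n) = Suc n"
    unfolding kernel_num_def using L_pos[of n] subdiag_nonzero[of n]
    by (subst degree_add_eq_right) (auto simp: degree_P)
  moreover from this have "kernel n \<noteq> 0"
    by (auto simp: kernel_num_eq)
  then have "degree (kernel_num n) = Suc (degree (kernel n))"
    unfolding kernel_num_eq by (subst degree_mult_eq) auto
  ultimately show ?thesis by simp
qed

text \<open>The weight t - x turns the kernel back into \<open>kernel_num\<close>. Orthogonality
  below n is then inherited from P_n and P_(n+1), and the moment at n is nonzero because
  \<open>L n n\<close> is.\<close>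

lemma E_kernel_monom:
  "E (kernel n * (monom 1 j * [:- x, 1:])) = L n n * E (P n * monom 1 j) + L (Suc n) n * E (P (Suc n) * monom 1 j)"
proof -
  have "kernel n * (monom 1 j * [:- x, 1:]) = kernel_num n * monom 1 j"
    unfolding kernel_num_eq by (simp only: mult_ac)
  then show ?thesis
    by (simp add: kernel_num_def distrib_right E_add E_smult)
qed

abbreviation kernel_C :: "nat \<Rightarrow> complex poly" where
  "kernel_C n \<equiv> map_poly of_real (kernel n)"

sublocale moment_expansion "shifted_markov_function \<mu> x" "\<lambda>k. of_real (E (monom 1 k * [:- x, 1:]))"
  by unfold_locales (rule shifted_markov_expansion)

lemma moment_of_real: "moment (map_poly of_real p) j = of_real (E (p * (monom 1 j * [:- x, 1:])))"
proof -
  have "p * (monom 1 j * [:- x, 1:]) = (\<Sum>i\<le>degree p. smult (coeff p i) (monom 1 (i + j) * [:- x, 1:]))"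
  proof -
    have "p * (monom 1 j * [:- x, 1:]) = (\<Sum>i\<le>degree p. monom (coeff p i) i) * (monom 1 j * [:- x, 1:])"
      by (simp only: poly_as_sum_of_monoms)
    also have "\<dots> = (\<Sum>i\<le>degree p. smult (coeff p i) (monom 1 (i + j) * [:- x, 1:]))"
      unfolding sum_distrib_right mult.assoc[symmetric] mult_monom
      by (intro sum.cong refl) (simp add: smult_monom mult_smult_left[symmetric] del: mult_pCons_right mult_smult_left)
    finally show ?thesis .
  qed
  moreover have "degree (map_poly complex_of_real p) = degree p"
    by (simp add: degree_map_poly)
  ultimately show ?thesis
    unfolding moment_def by (simp only: E_sum E_smult of_real_sum of_real_mult coeff_map_poly of_real_0)
qed

sublocale quasi_definite_moments "shifted_markov_function \<mu> x" "\<lambda>k. of_real (E (monom 1 k * [:- x, 1:]))" kernel_C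
proof unfold_locales
  fix n j
  show "degree (kernel_C n) = n"
    by (simp add: degree_map_poly degree_kernel)
  show "moment (kernel_C n) j = 0" if "j < n"
    unfolding moment_of_real E_kernel_monom using that by (simp add: E_P_monom)
  show "moment (kernel_C n) n \<noteq> 0"
    unfolding moment_of_real E_kernel_monom using L_pos[of n] E_P_monom_self[of n] by (simp add: E_P_monom)
qed

section \<open>Zeros of the kernel polynomials far from the support\<close>

abbreviation P_C :: "nat \<Rightarrow> complex \<Rightarrow> complex" where
  "P_C n \<equiv> poly (map_poly of_real (P n))"

definition P_prev :: "nat \<Rightarrow> complex \<Rightarrow> complex" where
  "P_prev n z = (if n = 0 then 0 else of_real (J n (n - 1)) * P_C (n - 1) z)"

lemma P_C_rec:
  "of_real (J n (Suc n)) * P_C (Suc n) z = (z - of_real (J n n)) * P_C n z - P_prev n z"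
proof -
  have "map_poly of_real (X * P n) = [:0, 1:] * map_poly complex_of_real (P n)"
    unfolding of_real_poly_mult by (simp add: map_poly_pCons)
  then have "z * P_C n z = poly (map_poly of_real (X * P n)) z"
    by simp
  then show ?thesis
    unfolding P_rec_poly P_prev_def
    by (cases n) (simp_all add: of_real_poly_add of_real_poly_smult algebra_simps)
qed

text \<open>Far from the support, \<open>P\<^sub>n\<close> dominates \<open>P\<^bsub>n-1\<^esub>\<close>, so that \<open>a\<^sub>n P\<^bsub>n+1\<^esub>(z) / P\<^sub>n(z) = z + O(1)\<close> uniformly in \<open>n\<close>.\<close>

lemma P_C_growth:
  assumes z: "3 \<le> cmod z"
  shows "P_C n z \<noteq> 0 \<and> cmod (P_prev n z) \<le> cmod (P_C n z)"
proof (induction n)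
  case 0
  show ?case by (simp add: P_prev_def P_0 map_poly_1)
next
  case (Suc n)
  have a: "0 < J n (Suc n)" "J n (Suc n) \<le> 1" and b: "\<bar>J n n\<bar> \<le> 1"
    using J_pos[of n] J_le_1[of n "Suc n"] J_le_1[of n n] by auto
  \<comment> \<open>The threshold 3 leaves |z - b_n| \<ge> 2: one copy of |P_n| may be lost to
    \<open>P_prev\<close>, another remains, and a_n \<le> 1 passes the bound on to P_(n+1).\<close>
  have "2 \<le> cmod (z - of_real (J n n))"
    using z b norm_triangle_ineq2[of z "of_real (J n n)"] by simp
  then have "2 * cmod (P_C n z) \<le> cmod ((z - of_real (J n n)) * P_C n z)"
    unfolding norm_mult by (rule mult_right_mono) simp
  moreover have "J n (Suc n) * cmod (P_C (Suc n) z) = cmod ((z - of_real (J n n)) * P_C n z - P_prev n z)"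
    using arg_cong[OF P_C_rec[of n z], of cmod] a by (simp add: norm_mult)
  ultimately have "cmod (P_C n z) \<le> J n (Suc n) * cmod (P_C (Suc n) z)"
    using Suc.IH norm_triangle_ineq2[of "(z - of_real (J n n)) * P_C n z" "P_prev n z"]
    by linarith
  moreover have "\<dots> \<le> 1 * cmod (P_C (Suc n) z)"
    using a by (intro mult_right_mono) auto
  moreover have "J n (Suc n) * cmod (P_C n z) \<le> 1 * cmod (P_C n z)"
    using a by (intro mult_right_mono) auto
  ultimately have "cmod (P_C n z) \<le> cmod (P_C (Suc n) z)"
      "J n (Suc n) * cmod (P_C n z) \<le> cmod (P_C (Suc n) z)"
    by linarith+
  then show ?case
    using Suc.IH a J_sym[of n "Suc n"] by (auto simp: P_prev_def norm_mult)
qed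

text \<open>Multiplication by G_nn L_nn produces the recurrence coefficient a_n in front of P_(n+1)
  and the pivot in front of P_n.\<close>

lemma kernel_num_C:
  "of_real (G n n * L n n) * poly (map_poly of_real (kernel_num n)) z
    = of_real (pivot n) * P_C n z + of_real (J n (Suc n)) * P_C (Suc n) z"
  unfolding kernel_num_def of_real_poly_add of_real_poly_smult J_offdiag pivot_def
  by (simp add: power2_eq_square algebra_simps)

text \<open>At a root with |z| \<ge> 3 the recurrence gives z - b_n + d_n =
  \<open>P_prev n z\<close> / P_n(z), of modulus at most 1. The summand 3 also covers the roots with
  |z| < 3.\<close>

lemma kernel_C_root_bound:
  assumes root: "poly (kernel_C n) z = 0"
  shows "cmod z \<le> \<bar>pivot n\<bar> + 3"
proof (cases "3 \<le> cmod z")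
  case True
  have "poly (map_poly of_real (kernel_num n)) z = 0"
    unfolding kernel_num_eq of_real_poly_mult by (simp add: root)
  then have "(z - of_real (J n n) + of_real (pivot n)) * P_C n z = P_prev n z"
    using kernel_num_C[of n z] P_C_rec[of n z] by (simp add: algebra_simps)
  then have "cmod (z - of_real (J n n) + of_real (pivot n)) * cmod (P_C n z) \<le> 1 * cmod (P_C n z)"
    using P_C_growth[OF True, of n] by (metis mult_1 norm_mult)
  then have "cmod (z - of_real (J n n - pivot n)) \<le> 1"
    using P_C_growth[OF True, of n] by (simp add: mult_le_cancel_right algebra_simps)
  then have "cmod z \<le> 1 + \<bar>J n n - pivot n\<bar>"
    using norm_triangle_sub[of z "of_real (J n n - pivot n)"] by (simp del: of_real_diff)
  then show ?thesis
    using J_le_1[of n n] by linarith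
qed simp

text \<open>A real root near -d_n comes from the intermediate value theorem for a_n P_(n+1) / P_n,
  which stays within 2 of the identity where |t| \<ge> 3. The threshold 10 keeps the interval of
  radius 3 around -d_n in that region, away from the zeros of P_n and from \<open>x\<close>.\<close>

lemma kernel_C_large_root:
  assumes large: "10 < \<bar>pivot n\<bar>"
  obtains z where "poly (kernel_C n) z = 0" "\<bar>pivot n\<bar> - 3 \<le> cmod z"
proof -
  define d where "d = pivot n"
  define r where "r t = J n (Suc n) * poly (P (Suc n)) t / poly (P n) t" for t
  have P_nz: "poly (P n) t \<noteq> 0" and r: "\<bar>r t - t\<bar> \<le> 2" if t: "3 \<le> \<bar>t\<bar>" for t
  proof -
    have g: "P_C n (of_real t) \<noteq> 0" "cmod (P_prev n (of_real t)) \<le> cmod (P_C n (of_real t))"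
      using P_C_growth[of "of_real t" n] t by auto
    then show nz: "poly (P n) t \<noteq> 0" by (simp add: of_real_poly_eval)
    have "complex_of_real (r t - t) * P_C n (of_real t)
        = of_real (J n (Suc n)) * P_C (Suc n) (of_real t) - of_real t * P_C n (of_real t)"
      using nz by (simp add: r_def of_real_poly_eval field_simps)
    also have "\<dots> = - (of_real (J n n) * P_C n (of_real t) + P_prev n (of_real t))"
      unfolding P_C_rec by (simp add: algebra_simps)
    finally have "\<bar>r t - t\<bar> * cmod (P_C n (of_real t)) = cmod (of_real (J n n) * P_C n (of_real t) + P_prev n (of_real t))"
      by (metis norm_minus_cancel norm_mult norm_of_real)
    also have "\<dots> \<le> \<bar>J n n\<bar> * cmod (P_C n (of_real t)) + cmod (P_prev n (of_real t))"
      by (rule order_trans[OF norm_triangle_ineq]) (simp add: norm_mult)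
    also have "\<dots> \<le> 1 * cmod (P_C n (of_real t)) + cmod (P_C n (of_real t))"
      by (intro add_mono mult_right_mono J_le_1 g) simp
    finally have "\<bar>r t - t\<bar> * cmod (P_C n (of_real t)) \<le> 2 * cmod (P_C n (of_real t))"
      by simp
    then show "\<bar>r t - t\<bar> \<le> 2" using g(1) by simp
  qed
  have far: "3 \<le> \<bar>t\<bar>" if "- d - 3 \<le> t" "t \<le> - d + 3" for t
    using that large unfolding d_def by linarith
  \<comment> \<open>The radius 3 exceeds the deviation 2, so \<open>r\<close> lies on the proper
    side of -d at both ends.\<close>
  have "\<exists>t\<ge>- d - 3. t \<le> - d + 3 \<and> r t = - d"
  proof (rule IVT')
    show "r (- d - 3) \<le> - d"
      using r[OF far, of "- d - 3"] by (auto simp: abs_le_iff)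
    show "- d \<le> r (- d + 3)"
      using r[OF far, of "- d + 3"] by (auto simp: abs_le_iff)
    show "continuous_on {- d - 3..- d + 3} r"
      unfolding r_def using P_nz far by (intro continuous_intros) auto
  qed simp
  then obtain t where t: "- d - 3 \<le> t" "t \<le> - d + 3" "r t = - d" by blast
  have "complex_of_real (G n n * L n n) * of_real (poly (kernel_num n) t)
      = of_real (pivot n * poly (P n) t + J n (Suc n) * poly (P (Suc n)) t)"
    using kernel_num_C[of n "of_real t"] by (simp add: of_real_poly_eval)
  also have "pivot n * poly (P n) t + J n (Suc n) * poly (P (Suc n)) t = 0"
    using t(3) P_nz[OF far[OF t(1,2)]] unfolding r_def d_def by (simp add: field_simps)
  finally have "poly (kernel_num n) t = 0"
    using L_pos[of n] sig_cases[of n] by auto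
  \<comment> \<open>\<open>kernel_num n\<close> vanishes at \<open>x\<close> in any case; a root of
    the factor \<open>kernel n\<close> requires a different point.\<close>
  moreover have "t \<noteq> x"
    using far[OF t(1,2)] x_bound by auto
  ultimately have "poly (kernel n) t = 0"
    unfolding kernel_num_eq by simp
  then have "poly (kernel_C n) (of_real t) = 0"
    by (simp add: of_real_poly_eval)
  moreover have "\<bar>pivot n\<bar> - 3 \<le> cmod (of_real t)"
    using t(1,2) unfolding d_def by (simp add: abs_if split: if_splits)
  ultimately show ?thesis by (rule that)
qed

theorem bounded_pade_poles_iff: "bounded (pade_poles (shifted_markov_function \<mu> x)) \<longleftrightarrow> bounded_matrix L"
  unfolding pade_poles_eq bounded_matrix_L_iff bounded_iff
proof
  assume "\<exists>C. \<forall>z\<in>{z. \<exists>n. poly (kernel_C n) z = 0}. cmod z \<le> C"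
  then obtain C where C: "\<And>z n. poly (kernel_C n) z = 0 \<Longrightarrow> cmod z \<le> C" by blast
  have "\<bar>pivot n\<bar> \<le> max 10 (C + 3)" for n
  proof (cases "10 < \<bar>pivot n\<bar>")
    case True
    then obtain z where "poly (kernel_C n) z = 0" "\<bar>pivot n\<bar> - 3 \<le> cmod z"
      by (rule kernel_C_large_root)
    with C[of n z] show ?thesis by simp
  qed simp
  then show "\<exists>C. \<forall>k. \<bar>pivot k\<bar> \<le> C" by blast
next
  assume "\<exists>C. \<forall>k. \<bar>pivot k\<bar> \<le> C"
  then obtain C where C: "\<And>k. \<bar>pivot k\<bar> \<le> C" by blast
  have "cmod z \<le> C + 3" if "poly (kernel_C n) z = 0" for z n
    using kernel_C_root_bound[OF that] C[of n] by linarith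
  then show "\<exists>C. \<forall>z\<in>{z. \<exists>n. poly (kernel_C n) z = 0}. cmod z \<le> C" by blast
qed

end

theorem theorem5p2:
  fixes J L G :: smatrix and \<mu> :: "real measure" and x :: real
  assumes "jacobi_matrix J"
    and "prob_space \<mu>" and "sets \<mu> = sets borel" and "infinite (measure_support \<mu>)"
    and "measure_support \<mu> \<subseteq> {-1..1}"
    and "corresponds_to J \<mu>"
    and "-1 < x" and "x < 1"
    and "LGL_factorization J x L G"
  shows "(definitizable G (generated_operator (shifted_darboux x L G)) \<longleftrightarrow>
            spectrum (generated_operator (shifted_darboux x L G)) - {of_real x}
              = spectrum (generated_operator J) - {of_real x}) \<and>
         (spectrum (generated_operator (shifted_darboux x L G)) - {of_real x}
              = spectrum (generated_operator J) - {of_real x} \<longleftrightarrow>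
            bounded (pade_poles (shifted_markov_function \<mu> x)))"
proof -
  obtain P where P: "orthonormal_polys \<mu> P" "P 0 = 1"
      "\<And>t i. (\<Sum>j. J i j * poly (P j) t) = t * poly (P i) t"
    using assms(6) unfolding corresponds_to_def by blast
  interpret jacobi_measure J \<mu> P
    by (rule jacobi_measure.intro) (use assms P in auto)
  interpret darboux_measure J L G x \<mu> P
    by unfold_locales (use assms tridiagonal_J in auto)
  show ?thesis
    using operator_equivalence[OF bounded_matrix_J J_sym] bounded_pade_poles_iff by blast
qed

end
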